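(* Let $t$ be a positive integer. If a graph $G$ has a circular drawing whose crossing graph has no topological $K_t$-minor, then $G$ has treewidth at most $6t^2+6t+1$.
   Context: A circular drawing of a graph $G$ places the vertices at distinct points on a circle and draws each edge as the straight line segment between its endpoints. Two edges cross if their segments intersect at a point that is not an endpoint of either. The crossing graph of the drawing has vertex set $E(G)$, two edges adjacent iff they cross. A graph has a topological $K_t$-minor if a subgraph of it is isomorphic to a subdivision of $K_t$. *)

theory Defs
  imports "HOL-Analysis.Analysis" "Graph_Theory.Graph_Theory"
begin

text \<open>
  Finite simple undirected graphs are values \<open>G\<close> with \<^term>\<open>pair_graph G\<close>: finite, loopless
  digraphs without parallel arcs and with a symmetric arc set, an edge \<open>uv\<close> being represented by
  the two arcs \<open>(u,v)\<close> and \<open>(v,u)\<close>.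
\<close>

definition edges :: "'a pair_pre_digraph \<Rightarrow> 'a set set" where
  "edges G = {{u, v} | u v. (u, v) \<in> parcs G}"


subsection \<open>Circular drawings and crossing graphs\<close>

definition circular_drawing :: "'a pair_pre_digraph \<Rightarrow> ('a \<Rightarrow> complex) \<Rightarrow> bool" where
  "circular_drawing G pos \<longleftrightarrow>
     inj_on pos (pverts G) \<and> (\<exists>c r. r > 0 \<and> pos ` pverts G \<subseteq> sphere c r)"

text \<open>
  For \<open>e = {u, v}\<close> the set \<open>convex hull (pos ` e)\<close> is the closed segment from \<open>pos u\<close> to
  \<open>pos v\<close>, see \<open>segment_convex_hull\<close>.
\<close>

definition edges_cross :: "('a \<Rightarrow> complex) \<Rightarrow> 'a set \<Rightarrow> 'a set \<Rightarrow> bool" where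
  "edges_cross pos e f \<longleftrightarrow>
     e \<noteq> f \<and> (\<exists>p \<in> convex hull (pos ` e) \<inter> convex hull (pos ` f). p \<notin> pos ` e \<and> p \<notin> pos ` f)"

definition crossing_graph ::
  "'a pair_pre_digraph \<Rightarrow> ('a \<Rightarrow> complex) \<Rightarrow> 'a set pair_pre_digraph" where
  "crossing_graph G pos =
     \<lparr> pverts = edges G,
       parcs = {(e, f). e \<in> edges G \<and> f \<in> edges G \<and> edges_cross pos e f} \<rparr>"


subsection \<open>Topological minors\<close>

text \<open>
  No separate isomorphism is needed: \<open>K\<close> ranges over all complete graphs on \<open>t\<close> vertices of the
  same vertex type as \<open>G\<close>, and any subgraph that is isomorphic to a subdivision of the complete
  graph on \<open>t\<close> vertices is itself a subdivision of such a \<open>K\<close>, whose vertices are the branch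
  vertices.
\<close>

definition has_topological_complete_minor :: "nat \<Rightarrow> 'a pair_pre_digraph \<Rightarrow> bool" where
  "has_topological_complete_minor t G \<longleftrightarrow>
     (\<exists>H. subgraph H (with_proj G) \<and>
        (\<exists>K rev_K rev_H. subdivision (K, rev_K) (H, rev_H) \<and> complete_digraph t K))"


subsection \<open>Treewidth\<close>

text \<open>
  The library's \<^const>\<open>tree\<close> does not fit symmetric digraphs: there, every edge gives a directed
  cycle of length 2. Cycles of an undirected graph are the directed cycles of length at least 3.
\<close>

definition undirected_tree :: "'a pair_pre_digraph \<Rightarrow> bool" where
  "undirected_tree T \<longleftrightarrow>
     pair_graph T \<and> Digraph_Component.connected (with_proj T) \<and>
     \<not> (\<exists>p. pre_digraph.cycle (with_proj T) p \<and> length p \<ge> 3)"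

text \<open>Digraphs satisfying \<^const>\<open>Digraph_Component.connected\<close> are nonempty.\<close>

definition tree_decomposition ::
  "'a pair_pre_digraph \<Rightarrow> 'b pair_pre_digraph \<Rightarrow> ('b \<Rightarrow> 'a set) \<Rightarrow> bool" where
  "tree_decomposition G T B \<longleftrightarrow>
     undirected_tree T \<and>
     (\<forall>x \<in> pverts T. B x \<subseteq> pverts G) \<and>
     (\<forall>(u, v) \<in> parcs G. \<exists>x \<in> pverts T. u \<in> B x \<and> v \<in> B x) \<and>
     (\<forall>v \<in> pverts G. Digraph_Component.connected (with_proj T \<restriction> {x \<in> pverts T. v \<in> B x}))"

definition decomposition_width :: "'b pair_pre_digraph \<Rightarrow> ('b \<Rightarrow> 'a set) \<Rightarrow> nat" where
  "decomposition_width T B = Max ((\<lambda>x. card (B x)) ` pverts T) - 1"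

text \<open>
  The trees are finite, so indexing them by natural numbers is no restriction. The graph without
  vertices gets treewidth 0.
\<close>

definition treewidth :: "'a pair_pre_digraph \<Rightarrow> nat" where
  "treewidth G =
     (LEAST k. \<exists>(T :: nat pair_pre_digraph) B.
        tree_decomposition G T B \<and> decomposition_width T B = k)"

end

theory Submission
  imports Defs
begin

text \<open>
  Number the vertices \<open>0, \<dots>, n - 1\<close> along the circle and let \<open>c x y\<close> be the number of edges that
  strictly cross the chord \<open>xy\<close>. If the polygon on the vertices has a triangulation all of whose
  chords satisfy \<open>c x y \<le> s\<close>, then taking for each triangle its corners and the endpoints of the
  edges crossing it gives a tree decomposition with bags of size at most \<open>3 + 3 s\<close>. The proof takes
  \<open>s = 2 t\<^sup>2\<close>.

  The depth of a point of the disc at a vertex \<open>v\<close> is the number of edges separating the two. If some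
  point has depth at least \<open>t\<^sup>2\<close> at every vertex, then the arcs cut off by the edges, on the sides away
  from the point, cover every vertex at least \<open>t\<^sup>2\<close> times. The \<open>t\<close> edges with the largest arcs serve
  as branch vertices. The remaining arcs contain \<open>t choose 2\<close> disjoint minimal covers of the circle,
  because a minimal cover covers no vertex more than twice. Each minimal cover is connected in the
  crossing graph, and each branch edge crosses one of its members, which gives a subdivision of the
  complete graph on \<open>t\<close> vertices.

  Otherwise label every point with a vertex at which its depth is below \<open>t\<^sup>2\<close>. Neighbouring points then
  get labels \<open>x\<close>, \<open>y\<close> with \<open>c x y \<le> s\<close>, so the boundary of the polygon is null-homologous in the
  complex of triangles whose sides satisfy this bound. As \<open>c\<close> satisfies the Kalmanson inequalities, a
  polygon that cannot be triangulated would carry a 1-cocycle on this complex that does not vanish on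
  the boundary.
\<close>

subsection \<open>Triangulations and Kalmanson costs\<close>

text \<open>Origin of the constants: a label has depth at most \<open>t^2 - 1\<close> at its point,
  and two points of one grid cell differ in at most two edges, so the chord between their labels
  crosses at most \<open>2 * (t^2 - 1) + 2 = 2 * t^2\<close> edges. The threshold
  \<open>t^2 = t + 2 * (t choose 2)\<close> leaves t edges for branch vertices and two layers for
  each cover. Bags of size at most \<open>3 + 6 * t^2\<close> give width at most
  \<open>6 * t^2 + 2\<close>, below the stated bound as t is positive. The obstacle is that a
  null-homology is not a triangulation: its triangles may overlap. Call a chord cheap if its cost is
  at most s. If every cheap chord xy other than a side has a corner v with both xv and vy cheaper
  than xy, then descent on the cost assigns to each cheap chord one of its two arcs, and these
  choices define a winding number. If some cheap chord has no such corner, the polygon is cut along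
  it: one part is again not triangulable, and the other part retracts onto the chord inside the
  complex, so that a cocycle of the bad part pulls back to the whole polygon.\<close>

definition btw :: "nat \<Rightarrow> nat \<Rightarrow> nat \<Rightarrow> bool" where
  "btw x v y \<longleftrightarrow> x < v \<and> v < y \<or> v < y \<and> y < x \<or> y < x \<and> x < v"

lemma btw_distinct: "btw x v y \<Longrightarrow> x \<noteq> v \<and> v \<noteq> y \<and> x \<noteq> y"
  by (auto simp: btw_def)

lemma btw_rotate: "btw x v y \<Longrightarrow> btw v y x"
  by (auto simp: btw_def)

lemma btw_total: "x \<noteq> v \<Longrightarrow> v \<noteq> y \<Longrightarrow> x \<noteq> y \<Longrightarrow> btw x v y \<or> btw y v x"
  by (auto simp: btw_def)

lemma btw_asym: "btw x v y \<Longrightarrow> \<not> btw y v x"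
  by (auto simp: btw_def)

lemma btw_split: "btw x v z \<Longrightarrow> btw x y z \<Longrightarrow> v \<noteq> y \<Longrightarrow> btw x v y \<or> btw y v z"
  by (auto simp: btw_def)

lemma btw_trans1: "btw x y z \<Longrightarrow> btw x v y \<Longrightarrow> btw x v z \<and> btw v y z"
  by (auto simp: btw_def)

lemma btw_trans2: "btw x y z \<Longrightarrow> btw y v z \<Longrightarrow> btw x v z \<and> btw x y v"
  by (auto simp: btw_def)

text \<open>For x, v, y, w in cyclic order, two opposite sides of the quadrilateral together cost at
  most as much as its diagonals. The other pair of sides follows by rotation in
  \<open>kalmanson'\<close>.\<close>

locale kalmanson =
  fixes c :: "nat \<Rightarrow> nat \<Rightarrow> nat" and s :: nat
  assumes c_sym: "c x y = c y x"
    and c_self: "c x x = 0"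
    and kalmanson: "btw x v y \<Longrightarrow> btw y w x \<Longrightarrow> c x v + c y w \<le> c x y + c v w"
begin

lemma kalmanson': "btw x v y \<Longrightarrow> btw y w x \<Longrightarrow> c v y + c w x \<le> c x y + c v w"
  using kalmanson[of v y w x] c_sym[of x y] by (auto simp: btw_def)

inductive triang :: "nat set \<Rightarrow> nat \<Rightarrow> nat \<Rightarrow> bool" for S where
  side: "x \<in> S \<Longrightarrow> y \<in> S \<Longrightarrow> x \<noteq> y \<Longrightarrow> (\<And>v. v \<in> S \<Longrightarrow> \<not> btw x v y) \<Longrightarrow> triang S x y"
| apex: "triang S x v \<Longrightarrow> triang S v y \<Longrightarrow> btw x v y \<Longrightarrow> c x v \<le> s \<Longrightarrow> c v y \<le> s \<Longrightarrow> triang S x y"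

text \<open>\<open>triang\<close> bounds the chords below xy but not xy itself, so the bound on the
  root is added here. Any chord may be the root; hence an exchange argument is finished as soon as
  one cheap chord is good in both directions.\<close>

definition triangulable :: "nat set \<Rightarrow> bool" where
  "triangulable S \<longleftrightarrow> (\<exists>x y. c x y \<le> s \<and> triang S x y \<and> triang S y x)"

text \<open>The cost strictly decreases towards the sides: this is what makes the exchange arguments below terminate.\<close>

inductive good :: "nat set \<Rightarrow> nat \<Rightarrow> nat \<Rightarrow> bool" for S where
  side: "x \<in> S \<Longrightarrow> y \<in> S \<Longrightarrow> x \<noteq> y \<Longrightarrow> (\<And>v. v \<in> S \<Longrightarrow> \<not> btw x v y) \<Longrightarrow> good S x y"
| apex: "good S x v \<Longrightarrow> good S v y \<Longrightarrow> btw x v y \<Longrightarrow> c x v < c x y \<Longrightarrow> c v y < c x y \<Longrightarrow> good S x y"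

lemma triang_in: "triang S x y \<Longrightarrow> x \<in> S \<and> y \<in> S \<and> x \<noteq> y"
  by (induction rule: triang.induct) (auto dest: btw_distinct)

lemma good_in: "good S x y \<Longrightarrow> x \<in> S \<and> y \<in> S \<and> x \<noteq> y"
  by (induction rule: good.induct) (auto dest: btw_distinct)

lemma good_triang: "good S x y \<Longrightarrow> c x y \<le> s \<Longrightarrow> triang S x y"
  by (induction rule: good.induct) (auto intro: triang.intros)

lemma good_apexE:
  assumes "good S x z" "y \<in> S" "btw x y z"
  obtains v where "good S x v" "good S v z" "btw x v z" "c x v < c x z" "c v z < c x z" "v \<in> S"
  using assms(1) by (cases rule: good.cases) (use assms(2,3) good_in in blast)+

text \<open>Both given good arcs pass the third corner of the triangle xyz. Moving a corner to the
  apex of one of them gives a cheaper configuration of the same kind, or makes a cheap chord good in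
  both directions, which would triangulate the polygon. \<open>W\<close> limits the known good arcs
  to chords of cost below \<open>W\<close>, so that the lemma is available inside the induction of
  \<open>good_arc_exists\<close>.\<close>

lemma two_large_arcs:
  assumes bad: "\<not> triangulable S"
    and cl: "\<And>u v. u \<in> S \<Longrightarrow> v \<in> S \<Longrightarrow> u \<noteq> v \<Longrightarrow> c u v < W \<Longrightarrow> good S u v \<or> good S v u"
    and "btw x y z" "c x y \<le> s" "c y z \<le> s" "c x z \<le> s" "c x y \<le> W" "c x z \<le> W"
    and "good S x z" "good S y x"
  shows False
  using assms(3-)
proof (induction "c x y + c x z" arbitrary: x y z rule: less_induct)
  case less
  note IH = less.hyps and P = less.prems
  have both: False if "good S p q" "good S q p" "c p q \<le> s" for p q
    using bad good_triang[of S] that unfolding triangulable_def by (metis c_sym)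
  have inS: "x \<in> S" "y \<in> S" "z \<in> S" using P good_in by blast+
  obtain v where v: "good S x v" "good S v z" "btw x v z" "c x v < c x z" "c v z < c x z" "v \<in> S"
    using good_apexE[OF P(7) inS(2) P(1)] by metis
  have "btw y z x" using P(1) by (rule btw_rotate)
  then obtain u where u: "good S y u" "good S u x" "btw y u x" "c y u < c y x" "c u x < c y x" "u \<in> S"
    using good_apexE[OF P(8) inS(3)] by metis
  have v_ne: "v \<noteq> y" using both[of x y] v(1) P by auto
  have u_ne: "u \<noteq> z" using both[of z x] u(2) P by (auto simp: c_sym)
  \<comment> \<open>If an apex falls between y and z, the corner z moves to v, or y moves to u. In
    the last case both apexes avoid that arc, and x is the corner that moves.\<close>
  consider (vr) "btw y v z" | (ul) "btw y u z" | (out) "btw x v y" "btw z u x"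
    using btw_split[OF v(3) P(1) v_ne] btw_split[OF u(3) \<open>btw y z x\<close> u_ne] by blast
  then show False
  proof cases
    case vr
    have o: "btw x y v" "btw v z x" using P(1) vr by (auto simp: btw_def)
    have "c y v + c z x \<le> c x v + c y z" using kalmanson'[OF o] by simp
    then have "c y v < c y z" using v(4) by (simp add: c_sym)
    then show False using IH[of x y v] o v P by (auto simp: c_sym)
  next
    case ul
    have o: "btw x y u" "btw u z x" "btw x u z" using P(1) ul by (auto simp: btw_def)
    have "c x y + c u z \<le> c x u + c y z" using kalmanson[OF o(1,2)] by simp
    then have "c u z < c y z" using u(5) by (simp add: c_sym)
    then show False using IH[of x u z] o u P by (auto simp: c_sym)
  next
    case out
    have o: "btw x v y" "btw y z x" "btw y z u" "btw x y z" "btw z u x" "btw v y z" "btw u y z"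
      using P(1) out by (auto simp: btw_def)
    have 1: "c v y + c z x \<le> c x y + c v z" using kalmanson'[OF o(1,2)] by simp
    have vy: "c v y < c x y" using 1 v(5) by (simp add: c_sym)
    have 2: "c x y + c z u \<le> c x z + c y u" using kalmanson[OF o(4,5)] by simp
    have zu: "c z u < c x z" using 2 u(4) by (simp add: c_sym)
    \<comment> \<open>The known bounds are crosswise, \<open>c x v < c x z\<close> and
      \<open>c x u < c x y\<close>. Comparing \<open>c x y\<close> with \<open>c x z\<close> turns
      one of them into the bound needed.\<close>
    have "c x v < c x y \<or> c x u < c x z" using v(4) u(5) by (auto simp: c_sym)
    then show False
    proof
      assume xv: "c x v < c x y"
      have "good S v y \<or> good S y v" using cl[of v y] vy P v inS v_ne by auto
      then show False
      proof
        assume "good S v y"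
        then have "good S x y" using good.apex[of S x v y] v o xv vy by auto
        then show False using both P by blast
      next
        assume "good S y v"
        then show False using IH[of v y z] o v P vy xv by (auto simp: c_sym)
      qed
    next
      assume xu: "c x u < c x z"
      have "good S z u \<or> good S u z" using cl[of z u] zu P u inS u_ne by auto
      then show False
      proof
        assume "good S z u"
        then have "good S z x" using good.apex[of S z u x] u o xu zu by (auto simp: c_sym)
        then show False using both[of x z] P by blast
      next
        assume "good S u z"
        then show False using IH[of u y z] o u P zu xu by (auto simp: c_sym)
      qed
    qed
  qed
qed

text \<open>As far as costs go, a violator can be the apex of a good arc over xy. A cheap chord
  without violators is one along which \<open>obstruction_cochain\<close> cuts.\<close>

definition violator :: "nat \<Rightarrow> nat \<Rightarrow> nat \<Rightarrow> bool" where
  "violator x y v \<longleftrightarrow> v \<noteq> x \<and> v \<noteq> y \<and> c x v < c x y \<and> c v y < c x y"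

lemma violator_sym: "violator x y v \<Longrightarrow> violator y x v"
  by (auto simp: violator_def c_sym)

definition is_side :: "nat set \<Rightarrow> nat \<Rightarrow> nat \<Rightarrow> bool" where
  "is_side S x y \<longleftrightarrow> x \<in> S \<and> y \<in> S \<and> x \<noteq> y \<and> (\<forall>v\<in>S. \<not> btw x v y)"

text \<open>Induction on the cost: a violator v yields two cheaper chords, which have good arcs. If
  both arcs stay on the side of v, then v is an apex. The other positions contradict
  \<open>two_large_arcs\<close> or the choice of v, or produce a good arc on the opposite side of
  the chord.\<close>

lemma good_arc_exists:
  assumes bad: "\<not> triangulable S"
    and fin: "finite S"
    and viol: "\<And>x y. x \<in> S \<Longrightarrow> y \<in> S \<Longrightarrow> x \<noteq> y \<Longrightarrow> c x y \<le> s \<Longrightarrow> \<not> is_side S x y \<Longrightarrow> \<not> is_side S y x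
           \<Longrightarrow> \<exists>v\<in>S. violator x y v"
    and "x \<in> S" "y \<in> S" "x \<noteq> y" "c x y \<le> s"
  shows "good S x y \<or> good S y x"
  using assms(4-)
proof (induction "c x y" arbitrary: x y rule: less_induct)
  case less
  have cl: "good S u v \<or> good S v u" if "u \<in> S" "v \<in> S" "u \<noteq> v" "c u v < c x y" for u v
    using less.hyps[OF that(4,1,2,3)] that less.prems by simp
  note FF = two_large_arcs[of S "c x y", OF bad cl]
  have *: "good S p q \<or> good S q p"
    if pq: "p \<in> S" "q \<in> S" "p \<noteq> q" "c p q = c x y"
      and w: "w \<in> S" "violator p q w" "btw p w q" for p q w
  proof -
    \<comment> \<open>Minimality of \<open>c p v + c v q\<close> over A handles the mixed cases: an
      apex of the arc that turns away from v cannot fall between p and q, since it would be a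
      violator with a smaller sum.\<close>
    define A where "A = {w\<in>S. violator p q w \<and> btw p w q}"
    have "finite A" "A \<noteq> {}" using fin w by (auto simp: A_def)
    then obtain v where vA: "v \<in> A" and vmin: "\<And>u. u \<in> A \<Longrightarrow> c p v + c v q \<le> c p u + c u q"
      using arg_min_if_finite[of A "\<lambda>v. c p v + c v q"]
        arg_min_least[of A _ "\<lambda>v. c p v + c v q"] by (metis (no_types, lifting))
    have v: "v \<in> S" "v \<noteq> p" "v \<noteq> q" "c p v < c p q" "c v q < c p q" "btw p v q"
      using vA by (auto simp: A_def violator_def)
    have s: "c p q \<le> s" using pq less.prems by simp
    have g1: "good S p v \<or> good S v p" using cl[of p v] v pq by auto
    have g2: "good S v q \<or> good S q v" using cl[of v q] v pq by auto
    have rot: "btw v q p" "btw q p v" using v(6) by (auto simp: btw_def)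
    consider (nn) "good S p v" "good S v q" | (ff) "good S v p" "good S q v"
      | (fn) "good S v p" "good S v q" | (nf) "good S p v" "good S q v"
      using g1 g2 by blast
    then show ?thesis
    proof cases
      case nn
      then show ?thesis using good.apex[of S p v q] v by auto
    next
      case ff
      then show ?thesis using FF[of v q p] rot v s pq by (auto simp: c_sym)
    next
      case fn
      obtain u where u: "good S v u" "good S u p" "btw v u p" "c v u < c v p" "c u p < c v p" "u \<in> S"
        using good_apexE[OF fn(1) pq(2) rot(1)] by metis
      have "u \<noteq> q" using u v by (auto simp: c_sym)
      then consider (a) "btw v u q" | (b) "btw q u p"
        using btw_split[OF u(3) rot(1)] by blast
      then show ?thesis
      proof cases
        case a
        have o: "btw p v u" "btw u q p" "btw p u q" using a v(6) by (auto simp: btw_def)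
        have "c p v + c u q \<le> c p u + c v q" using kalmanson[OF o(1,2)] by simp
        then have uq: "c u q < c v q" using u(5) by (simp add: c_sym)
        have "u \<in> A" using u uq v o btw_distinct[OF o(3)] by (auto simp: A_def violator_def c_sym)
        then show ?thesis using vmin[of u] uq u(5) by (simp add: c_sym)
      next
        case b
        have o: "btw p v q" "btw q u p" "btw u v q" using b v(6) by (auto simp: btw_def)
        have "c p v + c q u \<le> c p q + c v u" using kalmanson[OF o(1,2)] by simp
        then have qu: "c q u < c p q" using u(4) by (simp add: c_sym)
        have "good S q u \<or> good S u q" using cl[of q u] qu pq u \<open>u \<noteq> q\<close> by auto
        then show ?thesis
        proof
          assume "good S q u"
          then show ?thesis using good.apex[of S q u p] u b qu v by (auto simp: c_sym)
        next
          assume "good S u q"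
          then show ?thesis using FF[of u v q] o u v s pq qu by (auto simp: c_sym)
        qed
      qed
    next
      case nf
      obtain u where u: "good S q u" "good S u v" "btw q u v" "c q u < c q v" "c u v < c q v" "u \<in> S"
        using good_apexE[OF nf(2) pq(1) rot(2)] by metis
      have "u \<noteq> p" using u v by (auto simp: c_sym)
      then consider (a) "btw p u v" | (b) "btw q u p"
        using btw_split[OF u(3) rot(2)] by blast
      then show ?thesis
      proof cases
        case a
        have o: "btw p u v" "btw v q p" "btw p u q" using a v(6) by (auto simp: btw_def)
        have "c p u + c v q \<le> c p v + c u q" using kalmanson[OF o(1,2)] by simp
        then have uq: "c p u < c p v" using u(4) by (simp add: c_sym)
        have "u \<in> A" using u uq v o btw_distinct[OF o(3)] by (auto simp: A_def violator_def c_sym)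
        then show ?thesis using vmin[of u] uq u(4) by (simp add: c_sym)
      next
        case b
        have o: "btw p v q" "btw q u p" "btw u p v" using b v(6) by (auto simp: btw_def)
        have "c v q + c u p \<le> c p q + c v u" using kalmanson'[OF o(1,2)] by simp
        then have qu: "c u p < c p q" using u(5) by (simp add: c_sym)
        have "good S u p \<or> good S p u" using cl[of u p] qu pq u \<open>u \<noteq> p\<close> by auto
        then show ?thesis
        proof
          assume "good S u p"
          then show ?thesis using good.apex[of S q u p] u b qu v by (auto simp: c_sym)
        next
          assume "good S p u"
          then show ?thesis using FF[of u p v] o u v s pq qu by (auto simp: c_sym)
        qed
      qed
    qed
  qed
  show ?case
  proof (cases "is_side S x y \<or> is_side S y x")
    case True
    then show ?thesis by (auto simp: is_side_def intro: good.side)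
  next
    case False
    then obtain v where v: "v \<in> S" "violator x y v" using viol less.prems by blast
    then consider "btw x v y" | "btw y v x" using btw_total[of x v y] less.prems unfolding violator_def by metis
    then show ?thesis
      using *[of x y v] *[of y x v] v less.prems violator_sym by cases (auto simp: c_sym)
  qed
qed


section \<open>Cochains on the complex of cheap triangles\<close>

definition closed_cochain :: "nat set \<Rightarrow> (nat \<Rightarrow> nat \<Rightarrow> int) \<Rightarrow> bool" where
  "closed_cochain S \<phi> \<longleftrightarrow> (\<forall>x\<in>S. \<forall>y\<in>S. \<forall>z\<in>S. c x y \<le> s \<longrightarrow> c y z \<le> s \<longrightarrow> c z x \<le> s
     \<longrightarrow> \<phi> x y + \<phi> y z + \<phi> z x = 0)"

text \<open>The sides form a directed cycle, so this amounts to the sum of \<phi> around the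
  boundary being 0. A potential is easier to carry across a cut than a sum.\<close>

definition exact_on_sides :: "nat set \<Rightarrow> (nat \<Rightarrow> nat \<Rightarrow> int) \<Rightarrow> bool" where
  "exact_on_sides S \<phi> \<longleftrightarrow> (\<exists>h. \<forall>x y. is_side S x y \<longrightarrow> \<phi> x y = h y - h x)"

lemma closed_cochain_self: "closed_cochain S \<phi> \<Longrightarrow> x \<in> S \<Longrightarrow> \<phi> x x = 0"
  unfolding closed_cochain_def using c_self[of x] by force

text \<open>The triple x, y, x is a degenerate triangle of the complex because
  \<open>c x x = 0\<close>.\<close>

lemma closed_cochain_antisym:
  assumes "closed_cochain S \<phi>" "x \<in> S" "y \<in> S" "c x y \<le> s"
  shows "\<phi> y x = - \<phi> x y"
proof -
  have "\<phi> x y + \<phi> y x + \<phi> x x = 0"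
    using assms c_self[of x] c_sym[of x y] unfolding closed_cochain_def by (metis le0)
  then show ?thesis using closed_cochain_self[OF assms(1,2)] by simp
qed

lemma side_pred_exists:
  assumes "finite S" "v \<in> S" "u \<in> S" "u \<noteq> v"
  obtains p where "is_side S p v"
proof (cases "\<exists>w\<in>S. w < v")
  case True
  define p where "p = Max {w\<in>S. w < v}"
  have "p \<in> {w\<in>S. w < v}" unfolding p_def using True assms by (intro Max_in) auto
  moreover have "w \<le> p" if "w \<in> S" "w < v" for w unfolding p_def using that assms by auto
  ultimately have "is_side S p v" unfolding is_side_def btw_def using assms by force
  then show ?thesis by (rule that)
next
  case False
  have "Max S \<in> S" "\<And>w. w \<in> S \<Longrightarrow> w \<le> Max S" using assms by (auto intro!: Max_in)
  moreover have "Max S \<noteq> v"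
    by (metis False assms calculation(2) le_neq_implies_less)
  ultimately have "is_side S (Max S) v" unfolding is_side_def btw_def using assms False
    by (metis leD)
  then show ?thesis by (rule that)
qed

text \<open>The cochain counts how often the good arc from \<open>x\<close> to \<open>y\<close> passes the gap between the largest and the smallest
  corner. It is closed because exactly one of the three good arcs of a triangle contains the third corner.\<close>

lemma winding_cochain:
  assumes bad: "\<not> triangulable S"
    and fin: "finite S" and card: "u0 \<in> S" "v0 \<in> S" "u0 \<noteq> v0"
    and sides: "\<And>x y. is_side S x y \<Longrightarrow> c x y \<le> s"
    and viol: "\<And>x y. x \<in> S \<Longrightarrow> y \<in> S \<Longrightarrow> x \<noteq> y \<Longrightarrow> c x y \<le> s \<Longrightarrow> \<not> is_side S x y \<Longrightarrow> \<not> is_side S y x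
           \<Longrightarrow> \<exists>v\<in>S. violator x y v"
  shows "\<exists>\<phi>. closed_cochain S \<phi> \<and> \<not> exact_on_sides S \<phi>"
proof -
  have some: "good S x y \<or> good S y x" if "x \<in> S" "y \<in> S" "x \<noteq> y" "c x y \<le> s" for x y
    using good_arc_exists[OF bad fin viol that] by blast
  have both: False if "good S p q" "good S q p" "c p q \<le> s" for p q
    using bad good_triang[of S] that unfolding triangulable_def by (metis c_sym)
  \<comment> \<open>With \<open>W = Suc s\<close> the costs below \<open>W\<close> are those at most
    \<open>s\<close>, for which good arcs are known to exist.\<close>
  have FF: False if "btw x y z" "c x y \<le> s" "c y z \<le> s" "c x z \<le> s" "good S x z" "good S y x" for x y z
    using two_large_arcs[of S "Suc s" x y z, OF bad] some that by (simp add: less_Suc_eq_le)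
  define N :: "nat \<Rightarrow> nat \<Rightarrow> int" where "N x y = (if good S x y then 0 else 1)" for x y
  \<comment> \<open>Passing the gap in ascending cyclic direction counts positively. From x to a
    larger y the gap can only be passed backwards, hence the minus sign.\<close>
  define \<phi> where "\<phi> x y = (if x < y then - N x y else if y < x then N y x else 0)" for x y
  have sorted: "N x y + N y z = N x z"
    if m: "x \<in> S" "y \<in> S" "z \<in> S" and l: "x < y" "y < z" "c x y \<le> s" "c y z \<le> s" "c z x \<le> s" for x y z
  proof -
    have b: "btw x y z" "btw y z x" "btw z x y" using l by (auto simp: btw_def)
    \<comment> \<open>If no good arc contained the third corner, the triangle would complete a
      triangulation. Since \<open>FF\<close> excludes two such arcs, exactly one is left.\<close>
    have nnn: False if "good S x y" "good S y z" "good S z x"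
    proof -
      have "triang S x z" using that b l good_triang by (intro triang.apex[of S x y z]) auto
      moreover have "triang S z x" using that l good_triang by auto
      ultimately show False using bad l unfolding triangulable_def by metis
    qed
    have s: "c y x \<le> s" "c z y \<le> s" "c x z \<le> s" using l by (auto simp: c_sym)
    have "good S x y \<or> good S y x" "good S y z \<or> good S z y" "good S z x \<or> good S x z"
      using some m l s by auto
    moreover have "\<not> (good S x y \<and> good S y x)" "\<not> (good S y z \<and> good S z y)" "\<not> (good S z x \<and> good S x z)"
      using both l by blast+
    moreover have "\<not> (good S x z \<and> good S y x)" "\<not> (good S y x \<and> good S z y)" "\<not> (good S z y \<and> good S x z)"
      using FF[OF b(1)] FF[OF b(2)] FF[OF b(3)] l s by blast+
    ultimately show ?thesis using nnn unfolding N_def by auto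
  qed
  have cl: "closed_cochain S \<phi>"
    unfolding closed_cochain_def
  proof (intro ballI impI)
    fix x y z assume m: "x \<in> S" "y \<in> S" "z \<in> S" and l: "c x y \<le> s" "c y z \<le> s" "c z x \<le> s"
    have l': "c y x \<le> s" "c z y \<le> s" "c x z \<le> s" using l by (auto simp: c_sym)
    consider "x = y \<or> y = z \<or> z = x" | "x < y" "y < z" | "x < z" "z < y" | "y < x" "x < z" | "y < z" "z < x"
      | "z < x" "x < y" | "z < y" "y < x" by linarith
    then show "\<phi> x y + \<phi> y z + \<phi> z x = 0"
    proof cases
      case 1 then show ?thesis by (auto simp: \<phi>_def)
    next case 2 then show ?thesis using sorted[of x y z] m l l' by (simp add: \<phi>_def)
    next case 3 then show ?thesis using sorted[of x z y] m l l' by (simp add: \<phi>_def)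
    next case 4 then show ?thesis using sorted[of y x z] m l l' by (simp add: \<phi>_def)
    next case 5 then show ?thesis using sorted[of y z x] m l l' by (simp add: \<phi>_def)
    next case 6 then show ?thesis using sorted[of z x y] m l l' by (simp add: \<phi>_def)
    next case 7 then show ?thesis using sorted[of z y x] m l l' by (simp add: \<phi>_def)
    qed
  qed
  have "\<not> exact_on_sides S \<phi>"
  proof
    assume "exact_on_sides S \<phi>"
    then obtain h where h: "\<And>x y. is_side S x y \<Longrightarrow> \<phi> x y = h y - h x"
      unfolding exact_on_sides_def by blast
    have ne: "S \<noteq> {}" using card by blast
    let ?m = "Min S" and ?M = "Max S"
    have mM: "?m \<in> S" "?M \<in> S" "?m < ?M"
      using fin ne card
      by (auto intro: Min_in Max_in) (metis Max_ge Min_le le_less_trans linorder_neqE_nat not_le)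
    \<comment> \<open>\<phi> is 0 on every ascending side, so a potential is constant. The side from
      the largest to the smallest corner, where \<phi> is 1, then gives the contradiction.\<close>
    have const: "h x = h ?m" if "x \<in> S" for x
      using that
    proof (induction x rule: less_induct)
      case (less x)
      show ?case
      proof (cases "x = ?m")
        case False
        have "?m < x" using False less.prems fin by (simp add: order_less_le)
        obtain p where p: "is_side S p x" using side_pred_exists[OF fin less.prems mM(1)] False by metis
        have "p < x"
        proof (rule ccontr)
          assume "\<not> p < x"
          then have "btw p ?m x" using \<open>?m < x\<close> p by (auto simp: btw_def is_side_def)
          then show False using p mM by (auto simp: is_side_def)
        qed
        moreover have "good S p x" using p by (auto simp: is_side_def intro: good.side)
        ultimately have "\<phi> p x = 0" by (simp add: \<phi>_def N_def)
        then show ?thesis using h[OF p] less.IH[of p] \<open>p < x\<close> p by (auto simp: is_side_def)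
      qed simp
    qed
    have "is_side S ?M ?m"
      unfolding is_side_def btw_def using mM fin
      by (metis Max_ge Min_le linorder_not_less nat_neq_iff)
    moreover from this have "good S ?M ?m" by (auto simp: is_side_def intro: good.side)
    ultimately have "\<phi> ?M ?m = 1"
      using both[of ?M ?m] sides mM by (auto simp: \<phi>_def N_def)
    then show False using h[OF \<open>is_side S ?M ?m\<close>] const[OF mM(2)] by simp
  qed
  then show ?thesis using cl by blast
qed

section \<open>Re-rooting, cutting and gluing triangulations\<close>

lemma triang_rotate:
  assumes "triang S p q" "c p q \<le> s" "triang S q p" "is_side S y x" "y = p \<or> btw p y q"
  shows "triang S x y"
  using assms
proof (induction rule: triang.induct)
  case (side p q)
  have "y = p" using side by (auto simp: is_side_def)
  moreover have "x = q"
  proof (rule ccontr)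
    assume "x \<noteq> q"
    then have "btw p x q \<or> btw q x p" using side \<open>y = p\<close> by (intro btw_total) (auto simp: is_side_def)
    then show False
    proof
      assume "btw q x p"
      then have "btw p q x" by (auto simp: btw_def)
      then show False using side \<open>y = p\<close> by (auto simp: is_side_def)
    qed (use side in \<open>auto simp: is_side_def\<close>)
  qed
  ultimately show ?case using side by simp
next
  case (apex p v q)
  have b: "btw v q p" "btw q p v" using apex by (auto simp: btw_def)
  have "y = p \<or> btw p y v \<or> y = v \<or> btw v y q" using apex.prems(4) apex.hyps(3) btw_split by blast
  \<comment> \<open>Descend into the half that contains the side; the triangle p v q is handed over
    to the complementary arc of the new root chord.\<close>
  then consider "y = p \<or> btw p y v" | "y = v \<or> btw v y q" by blast
  then show ?case
  proof cases
    case 1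
    have "triang S v p" using apex b by (intro triang.apex[of S v q p]) (auto simp: c_sym)
    then show ?thesis using apex 1 by blast
  next
    case 2
    have "triang S q v" using apex b by (intro triang.apex[of S q p v]) (auto simp: c_sym)
    then show ?thesis using apex 2 by blast
  qed
qed

text \<open>Makes an arbitrary side the root. In \<open>triangulable_glue\<close> this is the cut
  chord, a side of both parts.\<close>

lemma triangulable_imp_triang:
  assumes "triangulable S" "is_side S y x"
  shows "triang S x y"
proof -
  obtain p q where pq: "c p q \<le> s" "triang S p q" "triang S q p"
    using assms by (auto simp: triangulable_def)
  have "p \<noteq> q" using pq triang_in by blast
  then have "(y = p \<or> btw p y q) \<or> (y = q \<or> btw q y p)" using btw_total[of p y q] by blast
  then show ?thesis using triang_rotate[OF pq(2,1,3) assms(2)] triang_rotate[OF pq(3) _ pq(2) assms(2)] pq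
    by (auto simp: c_sym)
qed

lemma triang_mono:
  assumes "triang T p q" "T \<subseteq> S" "\<And>w. w \<in> S \<Longrightarrow> btw p w q \<Longrightarrow> w \<in> T"
  shows "triang S p q"
  using assms
proof (induction rule: triang.induct)
  case (side p q)
  then show ?case by (intro triang.side) auto
next
  case (apex p v q)
  then show ?case using btw_trans1[of p v q] btw_trans2[of p v q] by (intro triang.apex[of S p v q]) blast+
qed

definition arc_corners :: "nat set \<Rightarrow> nat \<Rightarrow> nat \<Rightarrow> nat set" where
  "arc_corners S x y = {v\<in>S. v = x \<or> v = y \<or> btw x v y}"

text \<open>All removed corners lie on the open arc from y to x, so y and x are the only corners
  that can become newly adjacent.\<close>

lemma arc_corners_sides:
  assumes "is_side (arc_corners S x y) u v" "x \<in> S" "y \<in> S" "x \<noteq> y"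
  shows "is_side S u v \<or> u = y \<and> v = x"
proof (rule ccontr)
  assume neg: "\<not> ?thesis"
  then obtain w where w: "w \<in> S" "btw u w v" using assms by (auto simp: is_side_def arc_corners_def)
  have no: "\<not> btw u z v" if "z \<in> arc_corners S x y" for z using that assms by (auto simp: is_side_def)
  have "w \<notin> arc_corners S x y" using w no by blast
  then have wb: "btw y w x" using w assms btw_total[of x w y] by (auto simp: arc_corners_def)
  have nb: "\<not> btw u x v" "\<not> btw u y v" using no assms by (auto simp: arc_corners_def)
  have uv: "u = x \<or> u = y \<or> btw x u y" "v = x \<or> v = y \<or> btw x v y"
    using assms by (auto simp: is_side_def arc_corners_def)
  have "u = y"
  proof (rule ccontr)
    assume "u \<noteq> y"
    then have "btw u y w" using uv(1) wb by (auto simp: btw_def)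
    then show False using btw_trans1[OF w(2)] nb by blast
  qed
  moreover have "v = x"
  proof (rule ccontr)
    assume "v \<noteq> x"
    then have "btw w x v" using uv(2) wb by (auto simp: btw_def)
    then show False using btw_trans2[OF w(2)] nb by blast
  qed
  ultimately show False using neg by blast
qed

lemma arc_corners_side: "x \<in> S \<Longrightarrow> y \<in> S \<Longrightarrow> x \<noteq> y \<Longrightarrow> is_side (arc_corners S x y) y x"
  by (auto simp: is_side_def arc_corners_def btw_def)

lemma triangulable_glue:
  assumes "triangulable (arc_corners S x y)" "triangulable (arc_corners S y x)"
    and "x \<in> S" "y \<in> S" "x \<noteq> y" "c x y \<le> s"
  shows "triangulable S"
proof -
  have "triang (arc_corners S x y) x y" "triang (arc_corners S y x) y x"
    using assms triangulable_imp_triang arc_corners_side by metis+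
  then have "triang S x y" "triang S y x"
    by (auto elim!: triang_mono simp: arc_corners_def)
  then show ?thesis using assms unfolding triangulable_def by blast
qed

text \<open>Without violators, the corners beyond the chord \<open>xy\<close> can be retracted to \<open>x\<close> or \<open>y\<close> without increasing costs.\<close>

lemma cochain_extend:
  assumes fin: "finite S" and xy: "x \<in> S" "y \<in> S" "x \<noteq> y" "c x y \<le> s"
    and viol: "\<And>v. v \<in> S \<Longrightarrow> \<not> violator x y v"
    and cl: "closed_cochain (arc_corners S x y) \<phi>" and ne: "\<not> exact_on_sides (arc_corners S x y) \<phi>"
  shows "\<exists>\<psi>. closed_cochain S \<psi> \<and> \<not> exact_on_sides S \<psi>"
proof -
  let ?T = "arc_corners S x y"
  define r where "r v = (if v \<in> ?T then v else if c x y \<le> c v y then x else y)" for v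
  have T: "x \<in> ?T" "y \<in> ?T" using xy by (auto simp: arc_corners_def)
  have rT: "r v \<in> ?T" for v using T by (auto simp: r_def)
  have rid: "r v = v" if "v \<in> ?T" for v using that by (simp add: r_def)
  have rxy: "r v \<in> {x, y}" if "v \<notin> ?T" for v using that by (simp add: r_def)
  have out: "btw y v x" if "v \<in> S" "v \<notin> ?T" for v
    using that xy btw_total[of x v y] by (auto simp: arc_corners_def)
  have yx: "c y x \<le> s" using xy c_sym by simp
  \<comment> \<open>Kalmanson for x, u, y, v: if \<open>c x y \<le> c v y\<close>, it gives
    \<open>c u x \<le> c u v\<close>. Otherwise \<open>c x y \<le> c x v\<close>, as v is no
    violator, and it gives \<open>c u y \<le> c u v\<close>.\<close>
  have half: "c u (r v) \<le> s" if "u \<in> ?T" "v \<in> S" "v \<notin> ?T" "c u v \<le> s" for u v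
  proof (cases "u = x \<or> u = y")
    case True
    then show ?thesis using rxy[OF that(3)] xy yx c_self by auto
  next
    case False
    then have b: "btw x u y" "btw y v x" using that out by (auto simp: arc_corners_def)
    have vne: "v \<noteq> x" "v \<noteq> y" using that T by auto
    show ?thesis
    proof (cases "c x y \<le> c v y")
      case True
      then have "r v = x" using that by (simp add: r_def)
      then show ?thesis using kalmanson[OF b] True that(4) by (simp add: c_sym)
    next
      case F: False
      then have "r v = y" using that by (simp add: r_def)
      moreover have "c x y \<le> c x v" using viol[OF that(2)] F vne by (auto simp: violator_def)
      ultimately show ?thesis using kalmanson'[OF b] that(4) by (simp add: c_sym)
    qed
  qed
  have rl: "c (r u) (r v) \<le> s" if "u \<in> S" "v \<in> S" "c u v \<le> s" for u v
  proof (cases "u \<in> ?T"; cases "v \<in> ?T")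
    assume "u \<in> ?T" "v \<in> ?T" then show ?thesis using that rid by simp
  next
    assume "u \<in> ?T" "v \<notin> ?T" then show ?thesis using half that rid by simp
  next
    assume "u \<notin> ?T" "v \<in> ?T" then show ?thesis using half[of v u] that rid by (simp add: c_sym)
  next
    assume "u \<notin> ?T" "v \<notin> ?T" then show ?thesis using rxy[of u] rxy[of v] xy yx c_self by auto
  qed
  define \<psi> where "\<psi> u v = \<phi> (r u) (r v)" for u v
  have "closed_cochain S \<psi>"
    unfolding closed_cochain_def \<psi>_def
  proof (intro ballI impI)
    fix u v w assume "u \<in> S" "v \<in> S" "w \<in> S" "c u v \<le> s" "c v w \<le> s" "c w u \<le> s"
    then have "c (r u) (r v) \<le> s" "c (r v) (r w) \<le> s" "c (r w) (r u) \<le> s" using rl by auto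
    then show "\<phi> (r u) (r v) + \<phi> (r v) (r w) + \<phi> (r w) (r u) = 0"
      using cl rT[of u] rT[of v] rT[of w] unfolding closed_cochain_def by simp
  qed
  moreover have "\<not> exact_on_sides S \<psi>"
  proof
    assume "exact_on_sides S \<psi>"
    then obtain h where h: "\<And>u v. is_side S u v \<Longrightarrow> \<psi> u v = h v - h u"
      unfolding exact_on_sides_def by blast
    \<comment> \<open>A potential of \<phi> on the chord xy, normalised to vanish at y.\<close>
    define k where "k v = (if v = x then \<phi> y x else 0)" for v
    have \<phi>0: "\<phi> x x = 0" "\<phi> y y = 0" "\<phi> x y = - \<phi> y x"
      using closed_cochain_self[OF cl] closed_cochain_antisym[OF cl T(2,1)] T yx by auto
    have k: "\<phi> p q = k q - k p" if "p \<in> {x, y}" "q \<in> {x, y}" for p q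
      using that \<phi>0 xy by (auto simp: k_def)
    have rxy': "r v \<in> {x, y}" if "v = y \<or> v = x \<or> btw y v x" "v \<in> S" for v
      using that rid T rxy[of v] by (cases "v \<in> ?T") (auto simp: arc_corners_def btw_def)
    \<comment> \<open>Beyond the chord, \<psi> only takes values of \<phi> on the corners x and y,
      where \<phi> is the coboundary of k. So \<open>h v - k (r v)\<close> is constant along the
      sides from y to x, and h is a potential on the cut chord as well.\<close>
    have arc: "h v - k (r v) = h y" if "v \<in> S" "v = y \<or> v = x \<or> btw y v x" for v
      using that
    proof (induction "card {w\<in>S. btw y w v}" arbitrary: v rule: less_induct)
      case less
      show ?case
      proof (cases "v = y")
        case True
        then show ?thesis using rid[OF T(2)] xy by (simp add: k_def)
      next
        case False
        obtain p where p: "is_side S p v" using side_pred_exists[OF fin less.prems(1) xy(2)] False by metis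
        have "\<not> btw p y v" "p \<noteq> v" using p xy by (auto simp: is_side_def)
        then have pb: "p = y \<or> btw y p v" using False btw_total[of p y v] btw_rotate[of v y p] by blast
        have p2: "p = y \<or> p = x \<or> btw y p x" using pb less.prems(2) btw_trans1[of y v x p] btw_distinct by blast
        have "{w\<in>S. btw y w p} \<subset> {w\<in>S. btw y w v} \<or> p = y"
        proof (cases "p = y")
          case False
          then have "btw y p v" using pb by simp
          moreover have "p \<in> S" using p by (simp add: is_side_def)
          moreover have "\<not> btw y p p" using btw_distinct by blast
          ultimately show ?thesis using btw_trans1[of y p v] by blast
        qed simp
        then have "h p - k (r p) = h y"
        proof
          assume "p = y"
          then show ?thesis using rid[OF T(2)] xy by (simp add: k_def)
        next
          assume "{w\<in>S. btw y w p} \<subset> {w\<in>S. btw y w v}"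
          then have "card {w\<in>S. btw y w p} < card {w\<in>S. btw y w v}" using fin by (simp add: psubset_card_mono)
          then show ?thesis using less.hyps p p2 by (auto simp: is_side_def)
        qed
        moreover have "h v - h p = k (r v) - k (r p)"
          using h[OF p] k[of "r p" "r v"] rxy'[OF p2] rxy'[of v] less.prems p
          by (auto simp: \<psi>_def is_side_def)
        ultimately show ?thesis by linarith
      qed
    qed
    have "h x - k x = h y" using arc[of x] rid[OF T(1)] xy by simp
    then have last: "\<phi> y x = h x - h y" by (simp add: k_def)
    have "\<phi> u v = h v - h u" if "is_side ?T u v" for u v
    proof (cases "u = y \<and> v = x")
      case False
      then have "is_side S u v" using arc_corners_sides[OF that xy(1,2,3)] by blast
      moreover have "r u = u" "r v = v" using that rid by (auto simp: is_side_def)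
      ultimately show ?thesis using h[of u v] by (simp add: \<psi>_def)
    qed (use last in auto)
    then show False using ne unfolding exact_on_sides_def by blast
  qed
  ultimately show ?thesis by blast
qed

text \<open>Cuts are made along cheap chords without violators. By \<open>triangulable_glue\<close>
  one part stays untriangulable, and it has fewer corners because the chord is not a side. When no
  such chord is left, the winding cochain exists.\<close>

theorem obstruction_cochain:
  assumes "\<not> triangulable S" "finite S" "card S \<ge> 2"
    and "\<And>x y. is_side S x y \<Longrightarrow> c x y \<le> s"
  shows "\<exists>\<phi>. closed_cochain S \<phi> \<and> \<not> exact_on_sides S \<phi>"
  using assms
proof (induction "card S" arbitrary: S rule: less_induct)
  case less
  obtain u0 v0 where uv: "u0 \<in> S" "v0 \<in> S" "u0 \<noteq> v0"
    using \<open>card S \<ge> 2\<close> by (metis card_2_iff' card_le_Suc0_iff_eq less.prems(2) not_less_eq_eq numeral_2_eq_2)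
  show ?case
  proof (cases "\<forall>x\<in>S. \<forall>y\<in>S. x \<noteq> y \<longrightarrow> c x y \<le> s \<longrightarrow> \<not> is_side S x y \<longrightarrow> \<not> is_side S y x
           \<longrightarrow> (\<exists>v\<in>S. violator x y v)")
    case True
    then show ?thesis using winding_cochain[OF less.prems(1,2) uv less.prems(4)] by blast
  next
    case False
    then obtain x y where xy: "x \<in> S" "y \<in> S" "x \<noteq> y" "c x y \<le> s" "\<not> is_side S x y" "\<not> is_side S y x"
      and viol: "\<And>v. v \<in> S \<Longrightarrow> \<not> violator x y v" by blast
    have yx: "c y x \<le> s" using xy c_sym by simp
    have viol': "\<And>v. v \<in> S \<Longrightarrow> \<not> violator y x v" using viol violator_sym by blast
    have step: ?thesis if pq: "p \<in> S" "q \<in> S" "p \<noteq> q" "c p q \<le> s" "\<not> is_side S q p"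
      and v: "\<And>v. v \<in> S \<Longrightarrow> \<not> violator p q v" and nt: "\<not> triangulable (arc_corners S p q)" for p q
    proof -
      let ?T = "arc_corners S p q"
      obtain w where w: "w \<in> S" "btw q w p" using pq by (auto simp: is_side_def)
      then have "w \<notin> ?T" by (auto simp: arc_corners_def btw_def)
      then have "?T \<subset> S" using w by (auto simp: arc_corners_def)
      then have 1: "card ?T < card S" using less.prems(2) by (simp add: psubset_card_mono)
      have 2: "finite ?T" using less.prems(2) by (simp add: arc_corners_def)
      have "{p, q} \<subseteq> ?T" using pq by (auto simp: arc_corners_def)
      then have 3: "card ?T \<ge> 2" using pq 2 card_mono[of ?T "{p, q}"] by simp
      have "c u v \<le> s" if "is_side ?T u v" for u v
        using arc_corners_sides[OF that pq(1,2,3)] less.prems(4)[of u v] pq c_sym by auto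
      then obtain \<phi> where "closed_cochain ?T \<phi>" "\<not> exact_on_sides ?T \<phi>"
        using less.hyps[OF 1 nt 2 3] by blast
      then show ?thesis using cochain_extend[OF less.prems(2) pq(1,2,3,4) v] by blast
    qed
    have "\<not> triangulable (arc_corners S x y) \<or> \<not> triangulable (arc_corners S y x)"
      using triangulable_glue xy less.prems(1) by blast
    then show ?thesis
    proof
      assume "\<not> triangulable (arc_corners S x y)"
      then show ?thesis using step[of x y] xy viol by simp
    next
      assume "\<not> triangulable (arc_corners S y x)"
      then show ?thesis using step[of y x] xy yx viol' by simp
    qed
  qed
qed

end

subsection \<open>Depth and triangulability\<close>

definition separates :: "nat \<times> nat \<Rightarrow> nat \<Rightarrow> nat \<Rightarrow> bool" where
  "separates e x y \<longleftrightarrow> btw (fst e) x (snd e) \<and> btw (snd e) y (fst e) \<or> btw (fst e) y (snd e) \<and> btw (snd e) x (fst e)"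

definition crossings :: "(nat \<times> nat) set \<Rightarrow> nat \<Rightarrow> nat \<Rightarrow> nat" where
  "crossings E x y = card {e\<in>E. separates e x y}"

lemma separates_sym: "separates e x y \<longleftrightarrow> separates e y x"
  by (auto simp: separates_def)

text \<open>The chord ab has x on one side and v on the other. If y is not strictly on the side of
  v, then, going round from v, it lies at a or later; so w, which follows y and precedes x, lies
  strictly on the side of x.\<close>

lemma btw_cut:
  assumes "btw a x b" "btw b v a" "btw x v y" "btw y w x"
  shows "btw b y a \<or> btw a w b"
proof (rule ccontr)
  assume neg: "\<not> ?thesis"
  have xbv: "btw x b v" "btw x v a" using assms(1,2) by (auto simp: btw_def)
  have "y \<noteq> b" using xbv assms(3) by (auto simp: btw_def)
  have "a \<noteq> b" using assms(1) btw_distinct by blast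
  have "y = a \<or> btw a y x"
  proof (cases "y = a")
    case False
    then have "btw a y b" using neg btw_total[of a y b] \<open>y \<noteq> b\<close> \<open>a \<noteq> b\<close> by blast
    moreover have "y \<noteq> x" using assms(3) by (auto simp: btw_def)
    ultimately have "btw a y x \<or> btw x y b" using btw_split[of a y b x] assms(1) by blast
    moreover have "\<not> btw x y b" using btw_trans1[of x b v y] xbv assms(3) by (auto simp: btw_def)
    ultimately show ?thesis by blast
  qed simp
  then have "btw a w x" using assms(4) btw_trans2[of a y x w] by blast
  then show False using neg btw_trans1[OF assms(1)] by blast
qed

text \<open>The Kalmanson inequality edge by edge: an edge crossing a side of the quadrilateral
  crosses a diagonal, and by \<open>separates_uncross2\<close> an edge crossing two opposite sides
  crosses both diagonals.\<close>

lemma separates_uncross1: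
  assumes "btw x v y" "btw y w x" "separates e x v"
  shows "separates e x y \<or> separates e v w"
  using assms(3) btw_cut[of "fst e" x "snd e" v y w] btw_cut[of "snd e" x "fst e" v y w] assms(1,2)
  unfolding separates_def by blast

lemma separates_uncross2:
  assumes "btw x v y" "btw y w x" "separates e x v" "separates e y w"
  shows "separates e x y \<and> separates e v w"
  using assms(3,4) btw_cut[of "fst e" x "snd e" v y w] btw_cut[of "snd e" x "fst e" v y w] assms(1,2) btw_asym
  unfolding separates_def by metis

lemma crossings_kalmanson:
  assumes "finite E" "btw x v y" "btw y w x"
  shows "crossings E x v + crossings E y w \<le> crossings E x y + crossings E v w"
proof -
  let ?S = "\<lambda>x y. {e\<in>E. separates e x y}"
  have b: "btw y w x" "btw x v y" using assms by auto
  have fin: "finite (?S p q)" for p q using assms by auto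
  have "separates e x y \<or> separates e v w" if "separates e y w" for e
    using separates_uncross1[OF b that] separates_sym by blast
  then have 1: "?S x v \<union> ?S y w \<subseteq> ?S x y \<union> ?S v w"
    using separates_uncross1[OF assms(2,3)] by blast
  have 2: "?S x v \<inter> ?S y w \<subseteq> ?S x y \<inter> ?S v w"
    using separates_uncross2[OF assms(2,3)] by blast
  have "crossings E x v + crossings E y w = card (?S x v \<union> ?S y w) + card (?S x v \<inter> ?S y w)"
    unfolding crossings_def by (rule card_Un_Int[OF fin fin])
  also have "\<dots> \<le> card (?S x y \<union> ?S v w) + card (?S x y \<inter> ?S v w)"
    using 1 2 fin by (intro add_mono card_mono) auto
  also have "\<dots> = crossings E x y + crossings E v w"
    unfolding crossings_def by (rule card_Un_Int[OF fin fin, symmetric])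
  finally show ?thesis .
qed

lemma kalmanson_crossings: "finite E \<Longrightarrow> kalmanson (crossings E)"
proof
  show "crossings E x y = crossings E y x" for x y
    by (simp add: crossings_def separates_sym[of _ x y])
  show "crossings E x x = 0" for x
  proof -
    have "{e\<in>E. separates e x x} = {}" by (auto simp: separates_def dest: btw_asym)
    then show ?thesis unfolding crossings_def by (metis card.empty)
  qed
qed (rule crossings_kalmanson)

text \<open>A point of the disc is encoded by the set \<open>F\<close> of edges that separate it from vertex \<open>0\<close>. With respect to such a
  point, \<open>far_side F e\<close> is the open arc cut off by \<open>e\<close> on the other side.\<close>

definition far_side :: "(nat \<times> nat) set \<Rightarrow> nat \<times> nat \<Rightarrow> nat set" where
  "far_side F e = (if e \<in> F then {v. btw (snd e) v (fst e)} else {v. btw (fst e) v (snd e)})"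

definition depth :: "(nat \<times> nat) set \<Rightarrow> (nat \<times> nat) set \<Rightarrow> nat \<Rightarrow> nat" where
  "depth E F v = card {e\<in>E. v \<in> far_side F e}"

text \<open>Pairwise conditions that an actual point satisfies: if it is cut off from 0 by e, it is
  cut off by every f whose interval contains that of e, and the parts cut off by two edges of F both
  contain it, so their intervals overlap. The proof works with these conditions in place of a
  realising point.\<close>

definition consistent :: "(nat \<times> nat) set \<Rightarrow> (nat \<times> nat) set \<Rightarrow> bool" where
  "consistent E F \<longleftrightarrow> F \<subseteq> E
     \<and> (\<forall>e\<in>F. \<forall>f\<in>E. fst f \<le> fst e \<longrightarrow> snd e \<le> snd f \<longrightarrow> f \<in> F)
     \<and> (\<forall>e\<in>F. \<forall>f\<in>F. fst f < snd e)"

text \<open>An edge outside D has the points of F and F' on the same side. If it separates x from y,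
  one of the two vertices is on its far side.\<close>

lemma crossings_le_depth:
  assumes "finite E" "F \<subseteq> E" "F' \<subseteq> E" "F - F' \<union> (F' - F) \<subseteq> D" "finite D"
  shows "crossings E x y \<le> depth E F x + depth E F' y + card D"
proof -
  have "{e\<in>E. separates e x y} \<subseteq> {e\<in>E. x \<in> far_side F e} \<union> {e\<in>E. y \<in> far_side F' e} \<union> D"
  proof
    fix e assume e: "e \<in> {e\<in>E. separates e x y}"
    then show "e \<in> {e\<in>E. x \<in> far_side F e} \<union> {e\<in>E. y \<in> far_side F' e} \<union> D"
      using assms(4) by (cases "e \<in> F"; cases "e \<in> F'") (auto simp: far_side_def separates_def)
  qed
  then have "crossings E x y \<le> card ({e\<in>E. x \<in> far_side F e} \<union> {e\<in>E. y \<in> far_side F' e} \<union> D)"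
    unfolding crossings_def using assms by (intro card_mono) auto
  also have "\<dots> \<le> depth E F x + depth E F' y + card D"
    unfolding depth_def by (meson card_Un_le le_trans add_le_mono1)
  finally show ?thesis .
qed

section \<open>A labelled grid of points of the disc\<close>

locale shallow =
  fixes n d :: nat and E :: "(nat \<times> nat) set" and \<phi> :: "nat \<Rightarrow> nat \<Rightarrow> int"
  assumes E: "finite E" "\<And>e. e \<in> E \<Longrightarrow> fst e < snd e \<and> snd e < n"
    and n: "n \<ge> 1"
    and shallow: "\<And>F. consistent E F \<Longrightarrow> \<exists>v<n. depth E F v < d"
    and closed: "kalmanson.closed_cochain (crossings E) (2 * d) {..<n} \<phi>"
begin

interpretation kalmanson "crossings E" "2 * d"
  using kalmanson_crossings[OF E(1)] .

text \<open>Two keys order the edges \<open>(a, b)\<close> lexicographically: by \<open>a\<close> ascending, then \<open>b\<close> descending, and by \<open>b\<close>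
  descending, then \<open>a\<close> ascending. Thresholds for both keys give a grid of points in which neighbours
  differ in at most one edge, and the staircase bounding \<open>region\<close> passes the vertices \<open>0, \<dots>, n - 1\<close> in order.\<close>

definition flipped :: "nat \<Rightarrow> nat \<Rightarrow> (nat \<times> nat) set" where
  "flipped r m = {e\<in>E. fst e * (n + 1) + (n - snd e) < r \<and> (n - snd e) * (n + 1) + fst e < m}"

definition region :: "nat \<Rightarrow> nat \<Rightarrow> bool" where
  "region r m \<longleftrightarrow> (\<exists>i<n. r \<le> (i + 1) * (n + 1) \<and> m \<le> (n - i) * (n + 1))"

text \<open>The choice depends on the set of flipped edges and not on the thresholds, so grid points
  with equal sets get equal labels. This is what makes labels agree where \<open>flipped\<close> is
  empty.\<close>

definition nearest :: "(nat \<times> nat) set \<Rightarrow> nat" where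
  "nearest X = (SOME v. v < n \<and> depth E X v < d)"

definition lab :: "nat \<Rightarrow> nat \<Rightarrow> nat" where
  "lab r m = nearest (flipped r m)"

lemma key_less: "b < q + 1 \<Longrightarrow> a * (q + 1) + b < i * (q + 1) \<longleftrightarrow> a < (i::nat)"
proof
  assume "b < q + 1" "a * (q + 1) + b < i * (q + 1)"
  then show "a < i" by (metis add_lessD1 mult_less_cancel2)
next
  assume *: "b < q + 1" "a < i"
  then have "(a + 1) * (q + 1) \<le> i * (q + 1)" by (intro mult_right_mono) auto
  then show "a * (q + 1) + b < i * (q + 1)" using * by simp
qed

lemma flipped_mem_row: "e \<in> E \<Longrightarrow> fst e * (n + 1) + (n - snd e) < i * (n + 1) \<longleftrightarrow> fst e < i"
  by (rule key_less) simp

lemma flipped_mem_col: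
  assumes "e \<in> E" "i \<le> n"
  shows "(n - snd e) * (n + 1) + fst e < (n - i) * (n + 1) \<longleftrightarrow> i < snd e"
proof -
  have "fst e < n + 1" using E(2)[OF assms(1)] by simp
  then have "(n - snd e) * (n + 1) + fst e < (n - i) * (n + 1) \<longleftrightarrow> n - snd e < n - i" by (rule key_less)
  also have "\<dots> \<longleftrightarrow> i < snd e" using E(2)[OF assms(1)] assms(2) by linarith
  finally show ?thesis .
qed

text \<open>With the witness i of \<open>region\<close>, every flipped edge satisfies
  \<open>fst e \<le> i\<close> and \<open>i < snd e\<close>, so any two intervals overlap. Upward
  closure holds because an edge with a larger interval has both keys at most as large.\<close>

lemma consistent_flipped: "region r m \<Longrightarrow> consistent E (flipped r m)"
  unfolding consistent_def
proof (intro conjI ballI impI)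
  assume reg: "region r m"
  then obtain i where i: "i < n" "r \<le> (i + 1) * (n + 1)" "m \<le> (n - i) * (n + 1)" by (auto simp: region_def)
  show "flipped r m \<subseteq> E" by (auto simp: flipped_def)
  show "f \<in> flipped r m" if "e \<in> flipped r m" "f \<in> E" "fst f \<le> fst e" "snd e \<le> snd f" for e f
  proof -
    have "fst f * (n + 1) + (n - snd f) \<le> fst e * (n + 1) + (n - snd e)"
      "(n - snd f) * (n + 1) + fst f \<le> (n - snd e) * (n + 1) + fst e"
      using that by (intro add_mono mult_right_mono; simp)+
    then show ?thesis using that unfolding flipped_def by (metis (mono_tags, lifting) le_less_trans mem_Collect_eq)
  qed
  show "fst f < snd e" if "e \<in> flipped r m" "f \<in> flipped r m" for e f
  proof -
    have "fst f * (n + 1) + (n - snd f) < (i + 1) * (n + 1)" "(n - snd e) * (n + 1) + fst e < (n - i) * (n + 1)"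
      using that i unfolding flipped_def by auto
    moreover have "e \<in> E" "f \<in> E" using that by (auto simp: flipped_def)
    ultimately have "fst f < i + 1" "i < snd e"
      using flipped_mem_row[of f "i + 1"] flipped_mem_col[of e i] i(1) by auto
    then show ?thesis by simp
  qed
qed

lemma lab: "region r m \<Longrightarrow> lab r m < n \<and> depth E (flipped r m) (lab r m) < d"
  unfolding lab_def nearest_def using someI_ex[OF shallow[OF consistent_flipped]] by blast

lemma key_div_mod: "b < N \<Longrightarrow> (a * N + b) div N = a \<and> (a * N + b) mod N = (b::nat)"
  by simp

lemma flipped_step_row: "{e\<in>E. fst e * (n + 1) + (n - snd e) = r} \<subseteq> {(r div (n + 1), n - r mod (n + 1))}"
proof
  fix e assume e: "e \<in> {e\<in>E. fst e * (n + 1) + (n - snd e) = r}"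
  then have "snd e \<le> n" using E(2)[of e] by auto
  moreover have "r div (n + 1) = fst e \<and> r mod (n + 1) = n - snd e"
    using e key_div_mod[of "n - snd e" "n + 1" "fst e"] by auto
  ultimately show "e \<in> {(r div (n + 1), n - r mod (n + 1))}" by (auto simp: prod_eq_iff)
qed

lemma flipped_step_col: "{e\<in>E. (n - snd e) * (n + 1) + fst e = m} \<subseteq> {(m mod (n + 1), n - m div (n + 1))}"
proof
  fix e assume e: "e \<in> {e\<in>E. (n - snd e) * (n + 1) + fst e = m}"
  then have *: "fst e < n + 1" "snd e \<le> n" using E(2)[of e] by auto
  have "m div (n + 1) = n - snd e \<and> m mod (n + 1) = fst e"
    using e key_div_mod[OF *(1), of "n - snd e"] by blast
  then show "e \<in> {(m mod (n + 1), n - m div (n + 1))}" using * by (auto simp: prod_eq_iff)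
qed

lemma crossings_lab:
  assumes "r' \<in> {r, r + 1}" "r'' \<in> {r, r + 1}" "m' \<in> {m, m + 1}" "m'' \<in> {m, m + 1}"
    and "region r' m'" "region r'' m''"
  shows "crossings E (lab r' m') (lab r'' m'') \<le> 2 * d"
proof -
  \<comment> \<open>The only pairs whose row key is r or whose column key is m, decoded by quotient
    and remainder.\<close>
  let ?D = "{(r div (n + 1), n - r mod (n + 1)), (m mod (n + 1), n - m div (n + 1))}"
  have "flipped r' m' - flipped r'' m'' \<union> (flipped r'' m'' - flipped r' m')
      \<subseteq> {e\<in>E. fst e * (n + 1) + (n - snd e) = r} \<union> {e\<in>E. (n - snd e) * (n + 1) + fst e = m}"
    using assms(1-4) unfolding flipped_def by auto
  then have "flipped r' m' - flipped r'' m'' \<union> (flipped r'' m'' - flipped r' m') \<subseteq> ?D"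
    using flipped_step_row[of r] flipped_step_col[of m] by blast
  then have "crossings E (lab r' m') (lab r'' m'') \<le> depth E (flipped r' m') (lab r' m')
      + depth E (flipped r'' m'') (lab r'' m'') + card ?D"
    using E(1) by (intro crossings_le_depth) (auto simp: flipped_def)
  moreover have "card ?D \<le> 2" by (simp add: card_insert_if)
  ultimately show ?thesis using lab[OF assms(5)] lab[OF assms(6)] by linarith
qed

section \<open>Integrating the cochain along the labels\<close>

lemma triangle:
  assumes "x < n" "y < n" "z < n" "crossings E x y \<le> 2 * d" "crossings E y z \<le> 2 * d" "crossings E z x \<le> 2 * d"
  shows "\<phi> x y + \<phi> y z + \<phi> z x = 0"
  using closed assms unfolding closed_cochain_def by blast

lemma antisym: "x < n \<Longrightarrow> y < n \<Longrightarrow> crossings E x y \<le> 2 * d \<Longrightarrow> \<phi> y x = - \<phi> x y"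
  using closed_cochain_antisym[OF closed] by simp

lemma self: "x < n \<Longrightarrow> \<phi> x x = 0"
  using closed_cochain_self[OF closed] by simp

definition \<psi> :: "nat \<Rightarrow> nat \<Rightarrow> int" where
  "\<psi> r m = (\<Sum>k<r. \<phi> (lab k m) (lab (k + 1) m))"

lemma region_mono: "region r m \<Longrightarrow> r' \<le> r \<Longrightarrow> m' \<le> m \<Longrightarrow> region r' m'"
  unfolding region_def by (meson le_trans)

text \<open>A discrete Poincare lemma: a diagonal cuts each grid square into two triangles whose
  labels are pairwise cheap. At \<open>r = 0\<close> no edge is flipped, so the left edge of the
  grid contributes nothing.\<close>

lemma \<psi>_vertical:
  assumes "region r (m + 1)"
  shows "\<psi> r (m + 1) - \<psi> r m = \<phi> (lab r m) (lab r (m + 1))"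
  using assms
proof (induction r)
  case 0
  have "lab 0 (m + 1) = lab 0 m" by (simp add: lab_def flipped_def)
  moreover have "lab 0 m < n" using lab region_mono[OF 0] by simp
  ultimately show ?case using self by (simp add: \<psi>_def)
next
  case (Suc r)
  have reg: "region (r + 1) (m + 1)" "region (r + 1) m" "region r (m + 1)" "region r m"
    using region_mono[OF Suc.prems] by auto
  let ?a = "lab r m" and ?b = "lab (r + 1) m" and ?c = "lab (r + 1) (m + 1)" and ?e = "lab r (m + 1)"
  have l: "?a < n" "?b < n" "?c < n" "?e < n" using lab reg by auto
  have cr: "crossings E ?a ?b \<le> 2 * d" "crossings E ?b ?c \<le> 2 * d" "crossings E ?c ?a \<le> 2 * d"
    "crossings E ?a ?e \<le> 2 * d" "crossings E ?e ?c \<le> 2 * d"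
    using reg by (auto intro!: crossings_lab[of _ r _ _ m])
  have "\<phi> ?a ?b + \<phi> ?b ?c + \<phi> ?c ?a = 0" using triangle l cr by blast
  moreover have "\<phi> ?a ?e + \<phi> ?e ?c + \<phi> ?c ?a = 0" using triangle l cr by blast
  ultimately have "\<phi> ?a ?b + \<phi> ?b ?c = \<phi> ?a ?e + \<phi> ?e ?c" by linarith
  then show ?case using Suc.IH[OF reg(3)] by (simp add: \<psi>_def)
qed

lemma depth_0I: "(\<And>e. e \<in> E \<Longrightarrow> v \<notin> far_side X e) \<Longrightarrow> depth E X v = 0"
  unfolding depth_def by (metis (mono_tags, lifting) card.empty empty_Collect_eq)

text \<open>Here the column threshold admits exactly the edges with \<open>i < snd e\<close>; the
  row threshold admits all with \<open>fst e < i\<close> and none with \<open>i < fst e\<close>. So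
  no edge strictly separates the point from vertex i.\<close>

lemma depth_horizontal:
  assumes "i < n" "i * (n + 1) \<le> r" "r \<le> (i + 1) * (n + 1)"
  shows "depth E (flipped r ((n - i) * (n + 1))) i = 0"
proof (rule depth_0I)
  fix e assume e: "e \<in> E"
  note E' = E(2)[OF e]
  show "i \<notin> far_side (flipped r ((n - i) * (n + 1))) e"
  proof (cases "e \<in> flipped r ((n - i) * (n + 1))")
    case True
    then have "fst e < i + 1" "i < snd e"
      using flipped_mem_row[OF e, of "i + 1"] flipped_mem_col[OF e, of i] assms unfolding flipped_def by auto
    then show ?thesis using True by (auto simp: far_side_def btw_def)
  next
    case False
    then have "\<not> (fst e < i \<and> i < snd e)"
      using flipped_mem_row[OF e, of i] flipped_mem_col[OF e, of i] assms e unfolding flipped_def by auto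
    then show ?thesis using False E' by (auto simp: far_side_def btw_def)
  qed
qed

lemma depth_vertical:
  assumes "i + 1 < n" "(n - (i + 1)) * (n + 1) \<le> m" "m \<le> (n - i) * (n + 1)"
  shows "depth E (flipped ((i + 1) * (n + 1)) m) (i + 1) = 0"
proof (rule depth_0I)
  fix e assume e: "e \<in> E"
  note E' = E(2)[OF e]
  show "i + 1 \<notin> far_side (flipped ((i + 1) * (n + 1)) m) e"
  proof (cases "e \<in> flipped ((i + 1) * (n + 1)) m")
    case True
    then have "fst e < i + 1" "i < snd e"
      using flipped_mem_row[OF e, of "i + 1"] flipped_mem_col[OF e, of i] assms unfolding flipped_def by auto
    then show ?thesis using True by (auto simp: far_side_def btw_def)
  next
    case False
    then have "\<not> (fst e < i + 1 \<and> i + 1 < snd e)"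
      using flipped_mem_row[OF e, of "i + 1"] flipped_mem_col[OF e, of "i + 1"] assms e unfolding flipped_def by auto
    then show ?thesis using False E' by (auto simp: far_side_def btw_def)
  qed
qed

lemma crossings_boundary:
  assumes "depth E (flipped r m) v = 0" "region r m"
  shows "crossings E v (lab r m) \<le> 2 * d"
proof -
  have "crossings E v (lab r m) \<le> depth E (flipped r m) v + depth E (flipped r m) (lab r m) + card ({} :: (nat \<times> nat) set)"
    using E(1) by (intro crossings_le_depth[of E "flipped r m" "flipped r m" "{}"]) (auto simp: flipped_def)
  then show ?thesis using assms(1) lab[OF assms(2)] by simp
qed

text \<open>Vertex i has a cheap chord to every label of this stretch, so each step between
  consecutive labels can be rerouted through i and the sum telescopes.\<close>

lemma \<psi>_horizontal:
  assumes "i < n" "i * (n + 1) \<le> r" "r \<le> (i + 1) * (n + 1)"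
  defines "m \<equiv> (n - i) * (n + 1)"
  shows "\<psi> r m - \<psi> (i * (n + 1)) m = \<phi> (lab (i * (n + 1)) m) i + \<phi> i (lab r m)"
  using assms(2,3)
proof (induction r rule: dec_induct)
  have reg: "region k m" if "k \<le> (i + 1) * (n + 1)" for k
    using that assms(1) unfolding region_def m_def by blast
  have cr: "crossings E i (lab k m) \<le> 2 * d" if "i * (n + 1) \<le> k" "k \<le> (i + 1) * (n + 1)" for k
    using crossings_boundary depth_horizontal[OF assms(1) that] reg[OF that(2)] unfolding m_def by blast
  {
    case base
    then show ?case using antisym[OF assms(1) _ cr[of "i * (n + 1)"]] lab[OF reg] by simp
  next
    case (step r)
    have r: "r \<le> (i + 1) * (n + 1)" "r + 1 \<le> (i + 1) * (n + 1)" "i * (n + 1) \<le> r + 1" using step by auto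
    have l: "lab r m < n" "lab (r + 1) m < n" using lab reg r by auto
    have "crossings E (lab r m) (lab (r + 1) m) \<le> 2 * d"
      using reg r by (intro crossings_lab[of _ r _ _ m]) auto
    moreover have "crossings E (lab (r + 1) m) i \<le> 2 * d" using cr[of "r + 1"] r by (simp add: c_sym)
    ultimately have "\<phi> i (lab r m) + \<phi> (lab r m) (lab (r + 1) m) + \<phi> (lab (r + 1) m) i = 0"
      using triangle[OF assms(1) l] cr[of r] r step by blast
    moreover have "\<phi> (lab (r + 1) m) i = - \<phi> i (lab (r + 1) m)"
      using antisym[OF assms(1) l(2)] cr[of "r + 1"] r by blast
    ultimately show ?case using step.IH[OF r(1)] by (simp add: \<psi>_def)
  }
qed

lemma \<psi>_descend:
  assumes "i + 1 < n" "(n - (i + 1)) * (n + 1) \<le> m" "m \<le> (n - i) * (n + 1)"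
  defines "r \<equiv> (i + 1) * (n + 1)" and "m0 \<equiv> (n - (i + 1)) * (n + 1)"
  shows "\<psi> r m - \<psi> r m0 = \<phi> (lab r m0) (i + 1) + \<phi> (i + 1) (lab r m)"
  using assms(2,3)[folded m0_def]
proof (induction m rule: dec_induct)
  have reg: "region r k" if "k \<le> (n - i) * (n + 1)" for k
    using that assms(1) unfolding region_def r_def by (metis add_lessD1 order_refl)
  have cr: "crossings E (i + 1) (lab r k) \<le> 2 * d" if "m0 \<le> k" "k \<le> (n - i) * (n + 1)" for k
    using crossings_boundary depth_vertical[OF assms(1) that(1)[unfolded m0_def] that(2)] reg[OF that(2)]
    unfolding r_def by blast
  {
    case base
    then show ?case using antisym[OF assms(1) _ cr[of m0]] lab[OF reg] by simp
  next
    case (step m)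
    have m: "m \<le> (n - i) * (n + 1)" "m + 1 \<le> (n - i) * (n + 1)" "m0 \<le> m + 1" using step by auto
    have l: "lab r m < n" "lab r (m + 1) < n" using lab reg m by auto
    have "crossings E (lab r m) (lab r (m + 1)) \<le> 2 * d"
      using reg m by (intro crossings_lab[of _ r _ _ m]) auto
    moreover have "crossings E (lab r (m + 1)) (i + 1) \<le> 2 * d" using cr[of "m + 1"] m by (simp add: c_sym)
    ultimately have "\<phi> (i + 1) (lab r m) + \<phi> (lab r m) (lab r (m + 1)) + \<phi> (lab r (m + 1)) (i + 1) = 0"
      using triangle[OF assms(1) l] cr[of m] m step by blast
    moreover have "\<phi> (lab r (m + 1)) (i + 1) = - \<phi> (i + 1) (lab r (m + 1))"
      using antisym[OF assms(1) l(2)] cr[of "m + 1"] m by blast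
    moreover have "\<psi> r (m + 1) - \<psi> r m = \<phi> (lab r m) (lab r (m + 1))"
      using \<psi>_vertical reg m by blast
    ultimately show ?case using step.IH[OF m(1)] by simp
  }
qed

lemma side_crossings:
  assumes "is_side {..<n} x y" shows "crossings E x y = 0"
proof -
  have "\<not> separates e x y" if "e \<in> E" for e
  proof
    assume "separates e x y"
    then have "btw x (fst e) y \<or> btw x (snd e) y" by (auto simp: separates_def btw_def)
    then show False using assms E(2)[OF that] by (auto simp: is_side_def)
  qed
  then show ?thesis unfolding crossings_def by (metis (mono_tags, lifting) card.empty empty_Collect_eq)
qed

lemma is_side_Suc: "i + 1 < n \<Longrightarrow> is_side {..<n} i (i + 1)"
  by (auto simp: is_side_def btw_def)

text \<open>The path of labels along the staircase is traded for the path 0, 1, ..., k. At a corner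
  the label Q has cheap chords to both k and k + 1, and the triangle k, Q, k + 1 performs the
  switch.\<close>

lemma \<psi>_boundary:
  assumes "k < n"
  shows "\<psi> (k * (n + 1)) ((n - k) * (n + 1))
    = \<phi> (lab 0 (n * (n + 1))) 0 + (\<Sum>i<k. \<phi> i (i + 1)) + \<phi> k (lab (k * (n + 1)) ((n - k) * (n + 1)))"
  using assms
proof (induction k)
  case 0
  have reg: "region 0 (n * (n + 1))" using 0 unfolding region_def by (intro exI[of _ 0]) auto
  have "crossings E 0 (lab 0 (n * (n + 1))) \<le> 2 * d"
    using crossings_boundary[OF _ reg] depth_horizontal[of 0 0] 0 by simp
  then show ?case using antisym[of 0 "lab 0 (n * (n + 1))"] lab[OF reg] 0 by (simp add: \<psi>_def)
next
  case (Suc k)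
  define P where "P = lab (k * (n + 1)) ((n - k) * (n + 1))"
  define Q where "Q = lab ((k + 1) * (n + 1)) ((n - k) * (n + 1))"
  define P' where "P' = lab ((k + 1) * (n + 1)) ((n - (k + 1)) * (n + 1))"
  have k: "k < n" "k + 1 < n" using Suc by auto
  have reg: "region ((k + 1) * (n + 1)) ((n - k) * (n + 1))" unfolding region_def using k by blast
  have le: "(n - (k + 1)) * (n + 1) \<le> (n - k) * (n + 1)" "k * (n + 1) \<le> (k + 1) * (n + 1)"
    by (intro mult_right_mono; simp)+
  have regs: "region (k * (n + 1)) ((n - k) * (n + 1))" "region ((k + 1) * (n + 1)) ((n - (k + 1)) * (n + 1))"
    using region_mono[OF reg] le by auto
  have l: "P < n" "Q < n" "P' < n" unfolding P_def Q_def P'_def using lab reg regs by auto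
  have kP: "crossings E k P \<le> 2 * d"
    unfolding P_def using crossings_boundary[OF depth_horizontal] k regs le by blast
  have kQ: "crossings E k Q \<le> 2 * d"
    unfolding Q_def using crossings_boundary[OF depth_horizontal] k reg le by blast
  have k1Q: "crossings E (k + 1) Q \<le> 2 * d"
    unfolding Q_def using crossings_boundary[OF depth_vertical] k reg le by blast
  have kk: "crossings E (k + 1) k \<le> 2 * d"
    using side_crossings[OF is_side_Suc[OF k(2)]] by (simp add: c_sym)
  have "\<psi> ((k + 1) * (n + 1)) ((n - k) * (n + 1)) - \<psi> (k * (n + 1)) ((n - k) * (n + 1)) = \<phi> P k + \<phi> k Q"
    unfolding P_def Q_def using \<psi>_horizontal[OF k(1) le(2) order_refl] .
  moreover have "\<psi> ((k + 1) * (n + 1)) ((n - k) * (n + 1)) - \<psi> ((k + 1) * (n + 1)) ((n - (k + 1)) * (n + 1))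
      = \<phi> P' (k + 1) + \<phi> (k + 1) Q"
    unfolding P'_def Q_def using \<psi>_descend[OF k(2) le(1) order_refl] .
  moreover have "\<phi> P k = - \<phi> k P" using antisym[OF k(1) l(1) kP] .
  moreover have "crossings E (k + 1) P' \<le> 2 * d"
    unfolding P'_def using crossings_boundary[OF depth_vertical] k regs le by blast
  then have "\<phi> P' (k + 1) = - \<phi> (k + 1) P'" using antisym[OF k(2) l(3)] by blast
  moreover have "\<phi> k Q + \<phi> Q (k + 1) + \<phi> (k + 1) k = 0"
    using triangle[OF k(1) l(2) k(2) kQ _ kk] k1Q by (simp add: c_sym)
  moreover have "\<phi> Q (k + 1) = - \<phi> (k + 1) Q" using antisym[OF k(2) l(2) k1Q] .
  moreover have "\<phi> (k + 1) k = - \<phi> k (k + 1)" using antisym[OF k] kk by (simp add: c_sym)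
  ultimately show ?case using Suc.IH[OF k(1)] unfolding P_def[symmetric] by (simp add: P'_def)
qed

text \<open>No edge is flipped at the start of the staircase, where \<open>r = 0\<close>, nor in the
  last row \<open>?M\<close>, since \<open>snd e < n\<close>. Hence all these labels coincide, the
  path of labels closes up, and the sum of \<phi> around the boundary is 0.\<close>

lemma exact: "exact_on_sides {..<n} \<phi>"
proof -
  define h where "h x = (\<Sum>i<x. \<phi> i (i + 1))" for x
  let ?l = "lab 0 (n * (n + 1))" and ?M = "(n - (n - 1)) * (n + 1)"
  have emp: "flipped r ?M = {}" for r
    using flipped_mem_col[of _ "n - 1"] E(2) unfolding flipped_def by fastforce
  have emp0: "flipped 0 m = {}" for m by (simp add: flipped_def)
  have lab_eq: "lab r ?M = ?l" for r by (simp add: lab_def emp emp0 del: One_nat_def)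
  have reg: "region 0 (n * (n + 1))" using n unfolding region_def by (intro exI[of _ 0]) auto
  have ln: "?l < n" using lab[OF reg] by blast
  have "\<psi> ((n - 1) * (n + 1)) ?M = 0" unfolding \<psi>_def lab_eq using self[OF ln] by simp
  then have sum: "\<phi> ?l 0 + h (n - 1) + \<phi> (n - 1) ?l = 0"
    using \<psi>_boundary[of "n - 1"] n unfolding lab_eq h_def by simp
  have zero: "\<phi> (n - 1) 0 = - h (n - 1)" if n2: "n \<ge> 2"
  proof -
    have s: "is_side {..<n} (n - 1) 0" using n2 by (auto simp: is_side_def btw_def)
    have "depth E (flipped 0 (n * (n + 1))) 0 = 0" using depth_horizontal[of 0 0] n by simp
    then have 1: "crossings E 0 ?l \<le> 2 * d" using crossings_boundary reg by blast
    have "(n - 1) * (n + 1) \<le> (n - 1 + 1) * (n + 1)" by (intro mult_right_mono) auto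
    then have "depth E (flipped ((n - 1) * (n + 1)) ?M) (n - 1) = 0" using n by (intro depth_horizontal) auto
    then have "depth E {} (n - 1) = 0" unfolding emp .
    then have 2: "crossings E (n - 1) ?l \<le> 2 * d" using crossings_boundary[of 0 "n * (n + 1)" "n - 1"] reg emp0 by simp
    have "\<phi> ?l 0 + \<phi> 0 (n - 1) + \<phi> (n - 1) ?l = 0"
      using triangle[of ?l 0 "n - 1"] ln n 1 2 side_crossings[OF s] by (simp add: c_sym)
    moreover have "\<phi> (n - 1) 0 = - \<phi> 0 (n - 1)"
      using antisym[of 0 "n - 1"] n side_crossings[OF s] by (simp add: c_sym)
    ultimately show ?thesis using sum by simp
  qed
  have "\<phi> x y = h y - h x" if s: "is_side {..<n} x y" for x y
  proof (cases "x < y")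
    case True
    have "y = x + 1"
    proof (rule ccontr)
      assume "y \<noteq> x + 1"
      then have "btw x (x + 1) y" "x + 1 \<in> {..<n}" using True s by (auto simp: btw_def is_side_def)
      then show False using s by (auto simp: is_side_def)
    qed
    then show ?thesis by (simp add: h_def)
  next
    case False
    have xy: "x < n" "y < n" "x \<noteq> y" using s by (auto simp: is_side_def)
    have "y = 0"
    proof (rule ccontr)
      assume "y \<noteq> 0"
      then have "btw x 0 y" using False xy by (auto simp: btw_def)
      then show False using s xy by (auto simp: is_side_def)
    qed
    moreover have "x = n - 1"
    proof (rule ccontr)
      assume "x \<noteq> n - 1"
      then have "btw x (n - 1) y" "n - 1 < n" using False xy by (auto simp: btw_def)
      then show False using s by (auto simp: is_side_def)
    qed
    ultimately show ?thesis using zero xy by (simp add: h_def)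
  qed
  then show ?thesis unfolding exact_on_sides_def by blast
qed

end

theorem triangulable_if_shallow:
  assumes "finite E" "\<And>e. e \<in> E \<Longrightarrow> fst e < snd e \<and> snd e < n" "n \<ge> 2"
    and "\<And>F. consistent E F \<Longrightarrow> \<exists>v<n. depth E F v < d"
  shows "kalmanson.triangulable (crossings E) (2 * d) {..<n}"
proof (rule ccontr)
  interpret kalmanson "crossings E" "2 * d" using kalmanson_crossings[OF assms(1)] .
  assume "\<not> triangulable {..<n}"
  have "crossings E x y \<le> 2 * d" if s: "is_side {..<n} x y" for x y
  proof -
    \<comment> \<open>The zero cochain gives access to \<open>side_crossings\<close> before an
      obstruction is available.\<close>
    have "shallow n d E (\<lambda>_ _. 0)"
      using assms by unfold_locales (auto simp: closed_cochain_def)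
    then show ?thesis using shallow.side_crossings s by (metis le0)
  qed
  then obtain \<phi> where phi: "closed_cochain {..<n} \<phi>" "\<not> exact_on_sides {..<n} \<phi>"
    using obstruction_cochain[OF \<open>\<not> triangulable {..<n}\<close>] assms(3) by auto
  have "shallow n d E \<phi>" using assms phi(1) by unfold_locales auto
  then show False using shallow.exact phi(2) by blast
qed

subsection \<open>Deep points and covers of the circle\<close>

definition crosses :: "nat \<times> nat \<Rightarrow> nat \<times> nat \<Rightarrow> bool" where
  "crosses e f \<longleftrightarrow> separates e (fst f) (snd f)"

lemma btw_interleave: "btw a p b \<Longrightarrow> btw b q a \<Longrightarrow> btw p b q \<and> btw q a p"
  by (auto simp: btw_def)

definition arc_start :: "(nat \<times> nat) set \<Rightarrow> nat \<times> nat \<Rightarrow> nat" where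
  "arc_start F e = (if e \<in> F then snd e else fst e)"

definition arc_end :: "(nat \<times> nat) set \<Rightarrow> nat \<times> nat \<Rightarrow> nat" where
  "arc_end F e = (if e \<in> F then fst e else snd e)"

lemma far_side_arc: "far_side F e = {v. btw (arc_start F e) v (arc_end F e)}"
  by (auto simp: far_side_def arc_start_def arc_end_def)

lemma finite_max_exists:
  fixes \<mu> :: "'a \<Rightarrow> nat"
  assumes "finite A" "A \<noteq> {}"
  shows "\<exists>m\<in>A. \<forall>f\<in>A. \<mu> f \<le> \<mu> m"
proof -
  have "Max (\<mu> ` A) \<in> \<mu> ` A" using assms by (intro Max_in) auto
  then obtain m where "m \<in> A" "\<mu> m = Max (\<mu> ` A)" by auto
  then show ?thesis using assms(1) by (auto intro!: bexI[of _ m])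
qed

locale deep =
  fixes n :: nat and E F :: "(nat \<times> nat) set"
  assumes E: "finite E" "\<And>e. e \<in> E \<Longrightarrow> fst e < snd e \<and> snd e < n"
    and consistent: "consistent E F"
begin

abbreviation "st \<equiv> arc_start F"
abbreviation "en \<equiv> arc_end F"
abbreviation "far \<equiv> far_side F"

lemma en_less: "e \<in> E \<Longrightarrow> en e < n"
  using E(2)[of e] by (auto simp: arc_end_def)

text \<open>Otherwise the two far sides would close up around the circle and leave no room for the
  point. Consistency and the order of the endpoints exclude this in each of the four cases.\<close>

lemma not_wrap:
  assumes "e \<in> E" "f \<in> E" "btw (st e) (st f) (en e)" "btw (st f) (en e) (en f)"
  shows "btw (en e) (en f) (st e)"
proof -
  obtain a b a' b' where e: "e = (a, b)" "f = (a', b')" by (cases e; cases f)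
  have ab: "a < b" "a' < b'" using E(2) assms e by force+
  have c1: "e \<in> F \<Longrightarrow> f \<notin> F \<Longrightarrow> a < a' \<or> b' < b" and c1': "e \<notin> F \<Longrightarrow> f \<in> F \<Longrightarrow> a' < a \<or> b < b'"
    and c2: "e \<in> F \<Longrightarrow> f \<in> F \<Longrightarrow> a' < b \<and> a < b'"
    using consistent assms(1,2) unfolding consistent_def e by force+
  show ?thesis
  proof (cases "e \<in> F"; cases "f \<in> F")
    assume "e \<in> F" "f \<in> F"
    then show ?thesis using assms(3,4) ab c2 by (auto simp: arc_start_def arc_end_def e btw_def)
  next
    assume "e \<in> F" "f \<notin> F"
    then show ?thesis using assms(3,4) ab c1 by (auto simp: arc_start_def arc_end_def e btw_def)
  next
    assume "e \<notin> F" "f \<in> F"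
    then show ?thesis using assms(3,4) ab c1' by (auto simp: arc_start_def arc_end_def e btw_def)
  next
    assume "e \<notin> F" "f \<notin> F"
    then show ?thesis using assms(3,4) ab by (auto simp: arc_start_def arc_end_def e btw_def)
  qed
qed

text \<open>The far side of f must start inside that of e, as it would contain it otherwise, and by
  \<open>not_wrap\<close> it ends outside. So e separates the ends of f.\<close>

lemma crosses_if_covers_end:
  assumes "e \<in> E" "f \<in> E" "en e \<in> far f" "\<not> far e \<subseteq> far f"
  shows "crosses e f"
proof -
  have b: "btw (st f) (en e) (en f)" using assms(3) by (simp add: far_side_arc)
  have ne: "st e \<noteq> en e" using E(2)[OF assms(1)] by (auto simp: arc_start_def arc_end_def)
  have "btw (st e) (st f) (en e)"
  proof (rule ccontr)
    assume n: "\<not> ?thesis"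
    have "st f \<noteq> en e" using b btw_distinct by blast
    then have "st f = st e \<or> btw (en e) (st f) (st e)" using n btw_total[of "st e" "st f" "en e"] ne by metis
    then have "btw (st f) v (en e)" if "btw (st e) v (en e)" for v
      using that by (auto simp: btw_def)
    then have "far e \<subseteq> far f" using b btw_trans1 unfolding far_side_arc by blast
    then show False using assms(4) by blast
  qed
  moreover from this have "btw (en e) (en f) (st e)" using not_wrap assms b by blast
  ultimately show ?thesis
    unfolding crosses_def separates_def arc_start_def arc_end_def by (auto split: if_splits)
qed

section \<open>Minimal covers\<close>

definition covers :: "(nat \<times> nat) set \<Rightarrow> bool" where
  "covers C \<longleftrightarrow> (\<forall>v<n. \<exists>e\<in>C. v \<in> far e)"

definition minimal_cover :: "(nat \<times> nat) set \<Rightarrow> bool" where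
  "minimal_cover C \<longleftrightarrow> C \<subseteq> E \<and> covers C \<and> (\<forall>D. D \<subset> C \<longrightarrow> \<not> covers D)"

lemma minimal_cover_exists:
  assumes "covers A" "A \<subseteq> E"
  obtains C where "C \<subseteq> A" "minimal_cover C"
proof -
  have "finite A" using E(1) assms(2) finite_subset by blast
  then have "finite {C. C \<subseteq> A \<and> covers C}" by simp
  moreover have "A \<in> {C. C \<subseteq> A \<and> covers C}" using assms by simp
  ultimately obtain C where C: "C \<subseteq> A" "covers C" and min: "\<And>D. D \<subseteq> A \<Longrightarrow> covers D \<Longrightarrow> D \<subseteq> C \<Longrightarrow> C = D"
    using finite_has_minimal2[of "{C. C \<subseteq> A \<and> covers C}" A] by auto
  show ?thesis
  proof (rule that[of C])
    show "minimal_cover C"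
      unfolding minimal_cover_def
    proof (intro conjI allI impI notI)
      fix D assume "D \<subset> C" "covers D"
      then show False using min[of D] C(1) by blast
    qed (use C assms(2) in auto)
  qed (use C in auto)
qed

lemma minimal_cover_no_redundant:
  assumes "minimal_cover C" "e \<in> C" "D \<subseteq> C" "e \<notin> D"
  shows "\<not> far e \<inter> {..<n} \<subseteq> (\<Union>f\<in>D. far f)"
proof
  assume sub: "far e \<inter> {..<n} \<subseteq> (\<Union>f\<in>D. far f)"
  have "covers (C - {e})"
    unfolding covers_def
  proof (intro allI impI)
    fix v assume "v < n"
    then obtain f where "f \<in> C" "v \<in> far f" using assms(1) by (auto simp: minimal_cover_def covers_def)
    then show "\<exists>f\<in>C - {e}. v \<in> far f"
      using sub \<open>v < n\<close> assms(3,4) by (cases "f = e") auto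
  qed
  then show False using assms(1,2) unfolding minimal_cover_def by blast
qed

text \<open>Among the arcs through v, one reaching furthest back and one reaching furthest forward
  contain all vertices of the others, so a third arc is redundant.\<close>

lemma minimal_cover_le_2:
  assumes "minimal_cover C"
  shows "card {e\<in>C. v \<in> far e} \<le> 2"
proof (rule ccontr)
  assume big: "\<not> ?thesis"
  define A where "A = {e\<in>C. v \<in> far e}"
  have "finite C" using assms E(1) finite_subset by (auto simp: minimal_cover_def)
  then have finA: "finite A" by (simp add: A_def)
  have big': "card A > 2" using big by (simp add: A_def)
  then have "A \<noteq> {}" by auto
  define L where "L e = {w. w < n \<and> btw (st e) w v}" for e
  define R where "R e = {w. w < n \<and> btw v w (en e)}" for e
  have chL: "L e \<subseteq> L f \<or> L f \<subseteq> L e" if "e \<in> A" "f \<in> A" for e f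
  proof -
    have "st e \<noteq> v" "st f \<noteq> v" using that btw_distinct by (auto simp: A_def far_side_arc)
    then have "st e = st f \<or> btw (st e) (st f) v \<or> btw (st f) (st e) v"
      using btw_total[of "st e" "st f" v] btw_rotate by blast
    then consider "st e = st f" | "btw (st e) (st f) v" | "btw (st f) (st e) v" by blast
    then show ?thesis
    proof cases
      case 1 then show ?thesis by (simp add: L_def)
    next
      case 2 then have "L f \<subseteq> L e" using btw_trans2[OF 2] unfolding L_def by blast
      then show ?thesis ..
    next
      case 3 then have "L e \<subseteq> L f" using btw_trans2[OF 3] unfolding L_def by blast
      then show ?thesis ..
    qed
  qed
  have chR: "R e \<subseteq> R f \<or> R f \<subseteq> R e" if "e \<in> A" "f \<in> A" for e f
  proof -
    have "en e \<noteq> v" "en f \<noteq> v" using that btw_distinct by (auto simp: A_def far_side_arc)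
    then have "en e = en f \<or> btw v (en e) (en f) \<or> btw v (en f) (en e)"
      using btw_total[of v "en e" "en f"] btw_rotate by blast
    then consider "en e = en f" | "btw v (en e) (en f)" | "btw v (en f) (en e)" by blast
    then show ?thesis
    proof cases
      case 1 then show ?thesis by (simp add: R_def)
    next
      case 2 then have "R e \<subseteq> R f" using btw_trans1[OF 2] unfolding R_def by blast
      then show ?thesis ..
    next
      case 3 then have "R f \<subseteq> R e" using btw_trans1[OF 3] unfolding R_def by blast
      then show ?thesis ..
    qed
  qed
  obtain e1 where e1: "e1 \<in> A" "\<And>f. f \<in> A \<Longrightarrow> L f \<subseteq> L e1"
  proof -
    obtain m where m: "m \<in> A" "\<And>f. f \<in> A \<Longrightarrow> card (L f) \<le> card (L m)"
      using finite_max_exists[OF finA \<open>A \<noteq> {}\<close>, of "\<lambda>e. card (L e)"] by blast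
    have "L f \<subseteq> L m" if "f \<in> A" for f
      using chL[OF that m(1)] m(2)[OF that] card_seteq[of "L f" "L m"] by (auto simp: L_def)
    then show ?thesis using that m by blast
  qed
  obtain e2 where e2: "e2 \<in> A" "\<And>f. f \<in> A \<Longrightarrow> R f \<subseteq> R e2"
  proof -
    obtain m where m: "m \<in> A" "\<And>f. f \<in> A \<Longrightarrow> card (R f) \<le> card (R m)"
      using finite_max_exists[OF finA \<open>A \<noteq> {}\<close>, of "\<lambda>e. card (R e)"] by blast
    have "R f \<subseteq> R m" if "f \<in> A" for f
      using chR[OF that m(1)] m(2)[OF that] card_seteq[of "R f" "R m"] by (auto simp: R_def)
    then show ?thesis using that m by blast
  qed
  have "\<not> A \<subseteq> {e1, e2}"
  proof
    assume "A \<subseteq> {e1, e2}"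
    then have "card A \<le> card {e1, e2}" by (intro card_mono) auto
    then show False using big' by (auto simp: card_insert_if split: if_splits)
  qed
  then obtain e3 where e3: "e3 \<in> A" "e3 \<noteq> e1" "e3 \<noteq> e2" by blast
  have "far e3 \<inter> {..<n} \<subseteq> (\<Union>f\<in>{e1, e2}. far f)"
  proof
    fix w assume w: "w \<in> far e3 \<inter> {..<n}"
    have v3: "btw (st e3) v (en e3)" and v1: "btw (st e1) v (en e1)" and v2: "btw (st e2) v (en e2)"
      using e1 e2 e3 by (auto simp: A_def far_side_arc)
    have "w = v \<or> w \<in> L e3 \<or> w \<in> R e3"
      using w btw_split[of "st e3" w "en e3" v] v3 by (auto simp: far_side_arc L_def R_def)
    then consider "w = v" | "w \<in> L e1" | "w \<in> R e2" using e1(2)[OF e3(1)] e2(2)[OF e3(1)] by blast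
    then show "w \<in> (\<Union>f\<in>{e1, e2}. far f)"
    proof cases
      case 1 then show ?thesis using v1 by (simp add: far_side_arc)
    next
      case 2 then show ?thesis using btw_trans1[OF v1] by (simp add: far_side_arc L_def)
    next
      case 3 then show ?thesis using btw_trans2[OF v2] by (simp add: far_side_arc R_def)
    qed
  qed
  then show False using minimal_cover_no_redundant[OF assms, of e3 "{e1, e2}"] e1 e2 e3 by (auto simp: A_def)
qed

text \<open>The end of a member g lies in some member h, which crosses g because minimality forbids
  \<open>far g \<subseteq> far h\<close>. Following ends, the members reachable from e run round the
  whole circle; they cover it, so by minimality they are all of C.\<close>

lemma minimal_cover_connected:
  assumes "minimal_cover C" "e \<in> C" "f \<in> C"
  shows "(e, f) \<in> {(g, h). g \<in> C \<and> h \<in> C \<and> crosses g h}\<^sup>*"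
proof -
  let ?S = "{(g, h). g \<in> C \<and> h \<in> C \<and> crosses g h}"
  define R where "R = {g\<in>C. (e, g) \<in> ?S\<^sup>*}"
  have CE: "C \<subseteq> E" using assms by (simp add: minimal_cover_def)
  have succ: "\<exists>h\<in>R. en g \<in> far h" if "g \<in> R" for g
  proof -
    have g: "g \<in> C" "g \<in> E" using that CE by (auto simp: R_def)
    obtain h where h: "h \<in> C" "en g \<in> far h"
      using assms(1) en_less[OF g(2)] by (auto simp: minimal_cover_def covers_def)
    have "g \<noteq> h" using h btw_distinct by (auto simp: far_side_arc)
    then have "\<not> far g \<subseteq> far h" using minimal_cover_no_redundant[OF assms(1) g(1), of "{h}"] h by auto
    then have "crosses g h" using crosses_if_covers_end g h CE by blast
    then have "(g, h) \<in> ?S" using g h by blast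
    then have "h \<in> R" using that h unfolding R_def by (auto intro: rtrancl_into_rtrancl)
    then show ?thesis using h by blast
  qed
  have "covers R"
    unfolding covers_def
  proof (intro allI impI, rule ccontr)
    fix v assume v: "v < n" and no: "\<not> (\<exists>g\<in>R. v \<in> far g)"
    have "e \<in> R" using assms by (simp add: R_def)
    \<comment> \<open>Distance from the end of g forward to the uncovered vertex v. The next arc
      cannot jump over v without covering it, so it ends strictly closer.\<close>
    define \<mu> where "\<mu> g = card {w. w < n \<and> btw (en g) w v}" for g
    obtain g where g: "g \<in> R" and gmin: "\<And>h. h \<in> R \<Longrightarrow> \<mu> g \<le> \<mu> h"
      using \<open>e \<in> R\<close> exists_least_iff[of "\<lambda>k. \<exists>g\<in>R. \<mu> g = k"] by (metis leI)
    obtain h where h: "h \<in> R" "en g \<in> far h" using succ[OF g] by blast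
    \<comment> \<open>Since the end of h is covered from R, it differs from v.\<close>
    obtain h' where h': "h' \<in> R" "en h \<in> far h'" using succ[OF h(1)] by blast
    have ne: "en g \<noteq> v" "en h \<noteq> v" using h h' no by auto
    have b: "btw (st h) (en g) (en h)" "\<not> btw (st h) v (en h)"
      using h no by (auto simp: far_side_arc)
    have bt: "btw (en g) (en h) v"
    proof (rule ccontr)
      assume "\<not> ?thesis"
      then have "btw v (en h) (en g)" using ne btw_total[of "en g" "en h" v] btw_distinct[OF b(1)] by metis
      then have "btw (en g) v (en h)" using btw_rotate by blast
      then show False using btw_trans2[OF b(1)] b(2) by blast
    qed
    have "h \<in> E" using h CE by (auto simp: R_def)
    then have "en h < n" using en_less by blast
    have "{w. w < n \<and> btw (en h) w v} \<subset> {w. w < n \<and> btw (en g) w v}"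
      using btw_trans2[OF bt] bt \<open>en h < n\<close> btw_distinct by blast
    then have "\<mu> h < \<mu> g" unfolding \<mu>_def by (intro psubset_card_mono) auto
    then show False using gmin[OF h(1)] by simp
  qed
  moreover have "R \<subseteq> C" by (auto simp: R_def)
  ultimately have "R = C" using assms(1) unfolding minimal_cover_def by blast
  then show ?thesis using assms(3) by (auto simp: R_def)
qed

text \<open>Minimal covers are peeled off one by one; each takes at most 2 from the covering number
  of a vertex.\<close>

lemma disjoint_covers:
  assumes "A \<subseteq> E" "\<And>v. v < n \<Longrightarrow> 2 * k \<le> card {e\<in>A. v \<in> far e}"
  shows "\<exists>C. (\<forall>i<k. minimal_cover (C i) \<and> C i \<subseteq> A) \<and> (\<forall>i<k. \<forall>j<k. i \<noteq> j \<longrightarrow> C i \<inter> C j = {})"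
  using assms
proof (induction k arbitrary: A)
  case 0
  then show ?case by simp
next
  case (Suc k)
  have "covers A"
    unfolding covers_def
  proof (intro allI impI)
    fix v assume "v < n"
    then have "card {e\<in>A. v \<in> far e} \<noteq> 0" using Suc.prems(2) by force
    then have "{e\<in>A. v \<in> far e} \<noteq> {}" by (metis card.empty)
    then show "\<exists>e\<in>A. v \<in> far e" by blast
  qed
  then obtain D where D: "D \<subseteq> A" "minimal_cover D" using minimal_cover_exists Suc.prems(1) by metis
  have cov: "2 * k \<le> card {e\<in>A - D. v \<in> far e}" if "v < n" for v
  proof -
    have eq: "{e\<in>A. v \<in> far e} = {e\<in>A - D. v \<in> far e} \<union> {e\<in>D. v \<in> far e}" using D by auto
    have "card {e\<in>A. v \<in> far e} \<le> card {e\<in>A - D. v \<in> far e} + card {e\<in>D. v \<in> far e}"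
      unfolding eq by (rule card_Un_le)
    then have "2 * Suc k \<le> card {e\<in>A - D. v \<in> far e} + 2"
      using minimal_cover_le_2[OF D(2), of v] Suc.prems(2)[OF that] by (meson add_left_mono le_trans)
    then show ?thesis by simp
  qed
  have "\<exists>C. (\<forall>i<k. minimal_cover (C i) \<and> C i \<subseteq> A - D) \<and> (\<forall>i<k. \<forall>j<k. i \<noteq> j \<longrightarrow> C i \<inter> C j = {})"
    by (rule Suc.IH) (use Suc.prems(1) cov in blast)+
  then obtain C where C: "\<forall>i<k. minimal_cover (C i) \<and> C i \<subseteq> A - D" "\<forall>i<k. \<forall>j<k. i \<noteq> j \<longrightarrow> C i \<inter> C j = {}"
    by (elim exE conjE)
  show ?case
  proof (intro exI[of _ "C(k := D)"] conjI allI impI)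
    fix i assume "i < Suc k"
    then have "i = k \<or> i < k" by auto
    then show "minimal_cover ((C(k := D)) i)" "(C(k := D)) i \<subseteq> A" using C(1) D by auto
  next
    fix i j assume "i < Suc k" "j < Suc k" "i \<noteq> j"
    then consider "i < k" "j < k" | "i = k" "j < k" | "i < k" "j = k" by linarith
    then show "(C(k := D)) i \<inter> (C(k := D)) j = {}"
    proof cases
      case 1 then show ?thesis using C(2) \<open>i \<noteq> j\<close> by simp
    next
      case 2 then have "C j \<subseteq> A - D" using C(1) by blast
      then show ?thesis using 2 by auto
    next
      case 3 then have "C i \<subseteq> A - D" using C(1) by blast
      then show ?thesis using 3 by auto
    qed
  qed
qed

end

lemma largest_subset_exists:
  fixes \<mu> :: "'a \<Rightarrow> nat"
  assumes "finite A" "t \<le> card A"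
  obtains B where "B \<subseteq> A" "card B = t" "\<And>b e. b \<in> B \<Longrightarrow> e \<in> A - B \<Longrightarrow> \<mu> e \<le> \<mu> b"
  using assms(2)
proof (induction t arbitrary: thesis)
  case 0
  then show ?case by (metis card.empty empty_iff empty_subsetI)
next
  case (Suc t)
  obtain B where B: "B \<subseteq> A" "card B = t" "\<And>b e. b \<in> B \<Longrightarrow> e \<in> A - B \<Longrightarrow> \<mu> e \<le> \<mu> b"
    using Suc.IH Suc.prems(2) by (metis Suc_leD)
  have "A - B \<noteq> {}"
    using B Suc.prems(2) by (metis Diff_eq_empty_iff not_less_eq_eq order_refl subset_antisym)
  then obtain m where m: "m \<in> A - B" "\<And>e. e \<in> A - B \<Longrightarrow> \<mu> e \<le> \<mu> m"
    using finite_max_exists[of "A - B" \<mu>] assms(1) by blast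
  show ?case
  proof (rule Suc.prems(1)[of "insert m B"])
    show "card (insert m B) = Suc t" using B(2) m finite_subset[OF B(1) assms(1)] by simp
  qed (use B m in auto)
qed

theorem deep_imp_linked_covers:
  assumes "finite E" "\<And>e. e \<in> E \<Longrightarrow> fst e < snd e \<and> snd e < n" "consistent E F" "n \<ge> 1"
    and "\<And>v. v < n \<Longrightarrow> depth E F v \<ge> t ^ 2"
  obtains B C where "B \<subseteq> E" "card B = t"
    "\<And>i. i < t choose 2 \<Longrightarrow> C i \<subseteq> E - B"
    "\<And>i j. i < t choose 2 \<Longrightarrow> j < t choose 2 \<Longrightarrow> i \<noteq> j \<Longrightarrow> C i \<inter> C j = {}"
    "\<And>i e f. i < t choose 2 \<Longrightarrow> e \<in> C i \<Longrightarrow> f \<in> C i \<Longrightarrow> (e, f) \<in> {(g, h). g \<in> C i \<and> h \<in> C i \<and> crosses g h}\<^sup>*"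
    "\<And>i b. i < t choose 2 \<Longrightarrow> b \<in> B \<Longrightarrow> \<exists>f\<in>C i. crosses b f"
proof -
  interpret deep n E F using assms by unfold_locales auto
  have "t \<le> t ^ 2" by (simp add: power2_eq_square)
  also have "\<dots> \<le> card {e\<in>E. 0 \<in> far e}" using assms(4) assms(5)[of 0] by (auto simp: depth_def)
  also have "\<dots> \<le> card E" using assms(1) by (intro card_mono) auto
  finally obtain B where B: "B \<subseteq> E" "card B = t"
    "\<And>b e. b \<in> B \<Longrightarrow> e \<in> E - B \<Longrightarrow> card (far e \<inter> {..<n}) \<le> card (far b \<inter> {..<n})"
    using largest_subset_exists[where A = E and t = t and \<mu> = "\<lambda>e. card (far e \<inter> {..<n})", OF assms(1)] by blast
  have cov: "2 * (t choose 2) \<le> card {e\<in>E - B. v \<in> far e}" if "v < n" for v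
  proof -
    have finB: "finite B" using B assms(1) finite_subset by auto
    have "{e\<in>E. v \<in> far e} \<subseteq> {e\<in>E - B. v \<in> far e} \<union> B" by auto
    then have "card {e\<in>E. v \<in> far e} \<le> card ({e\<in>E - B. v \<in> far e} \<union> B)"
      using assms(1) finB by (intro card_mono) auto
    also have "\<dots> \<le> card {e\<in>E - B. v \<in> far e} + t" using card_Un_le[of "{e\<in>E - B. v \<in> far e}" B] B(2) by simp
    finally have "t ^ 2 \<le> card {e\<in>E - B. v \<in> far e} + t" using assms(5)[OF that] by (simp add: depth_def)
    moreover have "2 * (t choose 2) = t * (t - 1)"
      by (cases t) (auto simp: choose_two intro!: dvd_mult_div_cancel)
    ultimately show ?thesis by (simp add: power2_eq_square diff_mult_distrib2)
  qed
  have "\<exists>C. (\<forall>i<t choose 2. minimal_cover (C i) \<and> C i \<subseteq> E - B)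
      \<and> (\<forall>i<t choose 2. \<forall>j<t choose 2. i \<noteq> j \<longrightarrow> C i \<inter> C j = {})"
    by (rule disjoint_covers) (use cov in auto)
  then obtain C where C: "\<forall>i<t choose 2. minimal_cover (C i) \<and> C i \<subseteq> E - B"
    "\<forall>i<t choose 2. \<forall>j<t choose 2. i \<noteq> j \<longrightarrow> C i \<inter> C j = {}"
    by (elim exE conjE)
  \<comment> \<open>The arc of f contains the end of b, which the arc of b does not. If it contained
    the arc of b as well, it would have more vertices, against the choice of B as the edges with the
    largest arcs.\<close>
  have linked: "\<exists>f\<in>C i. crosses b f" if i: "i < t choose 2" and b: "b \<in> B" for i b
  proof -
    have bE: "b \<in> E" using b B by blast
    obtain f where f: "f \<in> C i" "en b \<in> far f"
      using C(1) i en_less[OF bE] unfolding minimal_cover_def covers_def by blast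
    have fE: "f \<in> E - B" using f C(1) i by blast
    have "\<not> far b \<subseteq> far f"
    proof
      assume "far b \<subseteq> far f"
      moreover have "en b \<notin> far b" using btw_distinct by (auto simp: far_side_arc)
      ultimately have "far b \<inter> {..<n} \<subset> far f \<inter> {..<n}" using f en_less[OF bE] by blast
      then have "card (far b \<inter> {..<n}) < card (far f \<inter> {..<n})" by (intro psubset_card_mono) auto
      then show False using B(3)[OF b fE] by simp
    qed
    then show ?thesis using crosses_if_covers_end[OF bE _ f(2)] fE f by blast
  qed
  show ?thesis
  proof (rule that[of B C])
    show "(e, f) \<in> {(g, h). g \<in> C i \<and> h \<in> C i \<and> crosses g h}\<^sup>*"
      if "i < t choose 2" "e \<in> C i" "f \<in> C i" for i e f
      using minimal_cover_connected C(1) that by simp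
  qed (use B C linked in auto)
qed

subsection \<open>Tree decompositions from parent functions\<close>

text \<open>Nodes are numbered with parents before children, so a tree grows by appending a node and
  acyclicity reduces to comparing numbers.\<close>

definition parent_tree :: "nat \<Rightarrow> (nat \<Rightarrow> nat) \<Rightarrow> nat pair_pre_digraph" where
  "parent_tree N par = \<lparr>pverts = {..<N},
     parcs = {(i, j). i < N \<and> j < N \<and> (0 < i \<and> j = par i \<or> 0 < j \<and> i = par j)}\<rparr>"

lemma parent_tree_smaller_neighbour:
  assumes "\<And>k. 0 < k \<Longrightarrow> k < N \<Longrightarrow> par k < k" "(i, j) \<in> parcs (parent_tree N par)" "j < i"
  shows "j = par i"
  using assms(1)[of j] assms(2,3) by (auto simp: parent_tree_def)

lemma pair_graph_parent_tree:
  assumes "\<And>k. 0 < k \<Longrightarrow> k < N \<Longrightarrow> par k < k"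
  shows "pair_graph (parent_tree N par)"
proof -
  have "parcs (parent_tree N par) \<subseteq> {..<N} \<times> {..<N}" by (auto simp: parent_tree_def)
  then have "finite (parcs (parent_tree N par))" by (rule finite_subset) simp
  moreover have "i \<noteq> j" if "(i, j) \<in> parcs (parent_tree N par)" for i j
    using that assms[of i] assms[of j] by (auto simp: parent_tree_def)
  then have "fst e \<noteq> snd e" if "e \<in> parcs (parent_tree N par)" for e using that by (cases e) auto
  moreover have "symmetric (with_proj (parent_tree N par))"
    by (auto simp: parent_tree_def symmetric_def sym_def)
  moreover have "fst e \<in> {..<N} \<and> snd e \<in> {..<N}" if "e \<in> parcs (parent_tree N par)" for e
    using that by (cases e) (auto simp: parent_tree_def)
  moreover have "pverts (parent_tree N par) = {..<N}" by (simp add: parent_tree_def)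
  ultimately show ?thesis by unfold_locales simp_all
qed

lemma pcas_nth: "pcas u p v \<Longrightarrow> Suc i < length p \<Longrightarrow> fst (p ! Suc i) = snd (p ! i)"
proof (induction p arbitrary: u i)
  case (Cons e p)
  then show ?case by (cases i; cases p) auto
qed simp

lemma pcas_hd_last: "pcas u p v \<Longrightarrow> p \<noteq> [] \<Longrightarrow> fst (hd p) = u \<and> snd (last p) = v"
  by (induction p arbitrary: u) auto

lemma pawalk_verts_tl: "pcas u p v \<Longrightarrow> tl (pawalk_verts u p) = map snd p"
proof -
  have "pcas u p v \<Longrightarrow> pawalk_verts u p = u # map snd p"
    by (induction p arbitrary: u) auto
  then show "pcas u p v \<Longrightarrow> tl (pawalk_verts u p) = map snd p" by simp
qed

text \<open>Both neighbours of the largest vertex on a cycle are smaller, hence equal to its parent.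
  As the vertices of a cycle are distinct, its length is at most 2.\<close>

lemma no_long_cycle_parent_tree:
  assumes par: "\<And>k. 0 < k \<Longrightarrow> k < N \<Longrightarrow> par k < k"
  shows "\<not> (\<exists>p. pre_digraph.cycle (with_proj (parent_tree N par)) p \<and> length p \<ge> 3)"
proof
  assume "\<exists>p. pre_digraph.cycle (with_proj (parent_tree N par)) p \<and> length p \<ge> 3"
  then obtain p u where p: "pre_digraph.awalk (with_proj (parent_tree N par)) u p u"
    "distinct (tl (pre_digraph.awalk_verts (with_proj (parent_tree N par)) u p))" "length p \<ge> 3"
    unfolding pre_digraph.cycle_def by blast
  have arcs: "set p \<subseteq> parcs (parent_tree N par)" and cas: "pcas u p u"
    using p(1) by (auto simp: pre_digraph.awalk_def cas_with_proj_eq)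
  have dist: "distinct (map snd p)" using p(2) pawalk_verts_tl[OF cas] by (simp add: awalk_verts_with_proj_eq)
  let ?L = "length p"
  have step: "fst (p ! (Suc i mod ?L)) = snd (p ! i)" if "i < ?L" for i
  proof (cases "Suc i < ?L")
    case True
    then show ?thesis using pcas_nth[OF cas True] by simp
  next
    case False
    then have "Suc i = ?L" using that by simp
    moreover have "p \<noteq> []" using p(3) by auto
    moreover have "i = ?L - 1" using calculation(1) by simp
    ultimately show ?thesis using pcas_hd_last[OF cas] by (simp add: last_conv_nth hd_conv_nth)
  qed
  define k where "k = Max (set (map snd p))"
  have "k \<in> set (map snd p)" unfolding k_def using p(3) by (intro Max_in) auto
  then obtain i where i: "i < ?L" "snd (p ! i) = k" by (auto simp: in_set_conv_nth)
  have max: "snd (p ! j) \<le> k" if "j < ?L" for j unfolding k_def using that by (intro Max_ge) auto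
  have nb: "snd (p ! j) \<noteq> fst (p ! j) \<and> p ! j \<in> parcs (parent_tree N par)" if "j < ?L" for j
  proof -
    have "p ! j \<in> parcs (parent_tree N par)" using arcs that by auto
    moreover have "i \<noteq> l" if "(i, l) \<in> parcs (parent_tree N par)" for i l
      using that par[of i] par[of l] by (auto simp: parent_tree_def)
    ultimately show ?thesis by (metis prod.collapse)
  qed
  \<comment> \<open>The cyclic predecessor of i, written so that natural subtraction does not
    truncate.\<close>
  define i' where "i' = (i + (?L - 1)) mod ?L"
  have i': "i' < ?L" "Suc i' mod ?L = i"
  proof -
    have "Suc (i + (?L - 1)) = i + ?L" using p(3) by linarith
    then have "Suc i' mod ?L = (i + ?L) mod ?L" unfolding i'_def mod_Suc_eq by (rule arg_cong)
    then show "Suc i' mod ?L = i" using i by simp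
    show "i' < ?L" unfolding i'_def using p(3) by (intro mod_less_divisor) linarith
  qed
  define j where "j = Suc i mod ?L"
  have j: "j < ?L" unfolding j_def using p(3) by (intro mod_less_divisor) linarith
  have a: "p ! i = (snd (p ! i'), k)" using step[OF i'(1)] i i' by (simp add: prod_eq_iff)
  have b: "p ! j = (k, snd (p ! j))" using step[OF i(1)] i by (simp add: prod_eq_iff j_def)
  have sm: "snd (p ! i') < k" using nb[OF i(1)] max[OF i'(1)] a by (metis fst_conv nat_less_le snd_conv)
  have sm2: "snd (p ! j) < k" using nb[OF j] max[OF j] b by (metis fst_conv nat_less_le)
  have "(snd (p ! i'), k) \<in> parcs (parent_tree N par)" using nb[OF i(1)] a by simp
  then have "(k, snd (p ! i')) \<in> parcs (parent_tree N par)" by (auto simp: parent_tree_def)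
  then have "snd (p ! i') = par k" using parent_tree_smaller_neighbour[OF par] sm by blast
  moreover have "(k, snd (p ! j)) \<in> parcs (parent_tree N par)" using nb[OF j] b by simp
  then have "snd (p ! j) = par k" using parent_tree_smaller_neighbour[OF par] sm2 by blast
  ultimately have "map snd p ! i' = map snd p ! j" using i' j by simp
  then have "i' = j" using nth_eq_iff_index_eq[OF dist, of i' j] i'(1) j by simp
  then have "Suc j mod ?L = i" using i' by simp
  then show False using p(3) i(1) unfolding j_def by (auto simp: mod_Suc split: if_splits)
qed

lemma connected_parent_tree_restrict:
  assumes "S \<subseteq> {..<N}" "m \<in> S" "\<And>k. k \<in> S \<Longrightarrow> k \<noteq> m \<Longrightarrow> 0 < k \<and> par k < k \<and> par k \<in> S"
  shows "Digraph_Component.connected (with_proj (parent_tree N par) \<restriction> S)"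
proof -
  let ?G = "with_proj (parent_tree N par) \<restriction> S"
  let ?R = "rtrancl_on S ((arcs_ends ?G)\<^sup>s)"
  have arc: "(k, par k) \<in> (arcs_ends ?G)\<^sup>s \<and> (par k, k) \<in> (arcs_ends ?G)\<^sup>s" if "k \<in> S" "k \<noteq> m" for k
  proof -
    have "(k, par k) \<in> arcs ?G" using that assms(1) assms(3)[OF that] by (auto simp: parent_tree_def)
    then have "(k, par k) \<in> arcs_ends ?G" by (force simp: arcs_ends_def arc_to_ends_def)
    then show ?thesis by (force simp: symcl_def)
  qed
  have to: "(k, m) \<in> ?R \<and> (m, k) \<in> ?R" if "k \<in> S" for k
    using that
  proof (induction k rule: less_induct)
    case (less k)
    show ?case
    proof (cases "k = m")
      case True
      then show ?thesis using assms(2) by auto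
    next
      case False
      then have "par k \<in> S" "par k < k" using assms(3) less.prems by auto
      then have "(par k, m) \<in> ?R" "(m, par k) \<in> ?R" using less.IH by auto
      then show ?thesis using arc[OF less.prems False] less.prems
        by (meson converse_rtrancl_on_into_rtrancl_on rtrancl_on_into_rtrancl_on)
    qed
  qed
  then show ?thesis
    unfolding connected_conv using assms(2) by (auto intro: rtrancl_on_trans)
qed

lemma undirected_tree_parent_tree:
  assumes "N \<ge> 1" "\<And>k. 0 < k \<Longrightarrow> k < N \<Longrightarrow> par k < k"
  shows "undirected_tree (parent_tree N par)"
proof -
  have "Digraph_Component.connected (with_proj (parent_tree N par) \<restriction> {..<N})"
  proof (rule connected_parent_tree_restrict[of _ _ 0])
    fix k assume "k \<in> {..<N}" "k \<noteq> 0"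
    then show "0 < k \<and> par k < k \<and> par k \<in> {..<N}" using assms(2)[of k] by simp
  qed (use assms(1) in auto)
  moreover have "with_proj (parent_tree N par) \<restriction> {..<N} = with_proj (parent_tree N par)"
    by (auto simp: induce_subgraph_def with_proj_def parent_tree_def)
  ultimately show ?thesis
    unfolding undirected_tree_def
    using pair_graph_parent_tree no_long_cycle_parent_tree assms(2) by metis
qed

text \<open>The running intersection property. It survives the appending of nodes, and it makes the
  nodes whose bags contain a given vertex a subtree, rooted at the first of them.\<close>

definition partial_decomposition :: "nat \<Rightarrow> (nat \<Rightarrow> nat) \<Rightarrow> (nat \<Rightarrow> 'a set) \<Rightarrow> bool" where
  "partial_decomposition N par B \<longleftrightarrow> N \<ge> 1 \<and>
     (\<forall>k. 0 < k \<longrightarrow> k < N \<longrightarrow> par k < k \<and> B k \<inter> (\<Union>j<k. B j) \<subseteq> B (par k))"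

lemma tree_decomposition_parent_tree:
  assumes pd: "partial_decomposition N par B"
    and sub: "\<And>k. k < N \<Longrightarrow> B k \<subseteq> pverts G"
    and verts: "\<And>v. v \<in> pverts G \<Longrightarrow> \<exists>k<N. v \<in> B k"
    and arcs: "\<And>u v. (u, v) \<in> parcs G \<Longrightarrow> \<exists>k<N. u \<in> B k \<and> v \<in> B k"
  shows "tree_decomposition G (parent_tree N par) B"
proof -
  have par: "\<And>k. 0 < k \<Longrightarrow> k < N \<Longrightarrow> par k < k" and N: "N \<ge> 1"
    using pd by (auto simp: partial_decomposition_def)
  have V: "pverts (parent_tree N par) = {..<N}" by (simp add: parent_tree_def)
  have "Digraph_Component.connected (with_proj (parent_tree N par) \<restriction> {x \<in> pverts (parent_tree N par). v \<in> B x})"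
    if v: "v \<in> pverts G" for v
  proof -
    let ?S = "{x \<in> {..<N}. v \<in> B x}"
    define m where "m = (LEAST k. k < N \<and> v \<in> B k)"
    have m: "m < N \<and> v \<in> B m" unfolding m_def using verts[OF v] by (rule LeastI_ex)
    have least: "m \<le> k" if "k < N" "v \<in> B k" for k unfolding m_def using that by (intro Least_le) auto
    show ?thesis
      unfolding V
    proof (rule connected_parent_tree_restrict[of _ _ m])
      fix k assume k: "k \<in> ?S" "k \<noteq> m"
      then have "m < k" using least[of k] by auto
      then have "0 < k" "k < N" "v \<in> B k \<inter> (\<Union>j<k. B j)" using k m by auto
      then have "v \<in> B (par k)" "par k < k" using pd unfolding partial_decomposition_def by blast+
      then show "0 < k \<and> par k < k \<and> par k \<in> ?S" using \<open>0 < k\<close> \<open>k < N\<close> by auto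
    qed (use m in auto)
  qed
  then show ?thesis
    unfolding tree_decomposition_def V using undirected_tree_parent_tree[OF N par] sub arcs by fastforce
qed

lemma treewidth_le_if_partial_decomposition:
  assumes "partial_decomposition N par B"
    and "\<And>k. k < N \<Longrightarrow> B k \<subseteq> pverts G"
    and "\<And>v. v \<in> pverts G \<Longrightarrow> \<exists>k<N. v \<in> B k"
    and "\<And>u v. (u, v) \<in> parcs G \<Longrightarrow> \<exists>k<N. u \<in> B k \<and> v \<in> B k"
    and "\<And>k. k < N \<Longrightarrow> card (B k) \<le> w + 1"
  shows "treewidth G \<le> w"
proof -
  have N: "N \<ge> 1" using assms(1) by (simp add: partial_decomposition_def)
  have "treewidth G \<le> decomposition_width (parent_tree N par) B"
    unfolding treewidth_def using tree_decomposition_parent_tree[OF assms(1-4)] by (intro Least_le) blast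
  also have "\<dots> \<le> w"
  proof -
    have "0 \<in> {..<N}" using N by simp
    then have "{..<N} \<noteq> {}" by blast
    then have "Max ((\<lambda>x. card (B x)) ` {..<N}) \<le> w + 1" using assms(5) by (subst Max_le_iff) auto
    then show ?thesis by (simp add: decomposition_width_def parent_tree_def)
  qed
  finally show ?thesis .
qed

subsection \<open>Tree decompositions from triangulations\<close>

lemma separates_iff:
  "separates e x y \<longleftrightarrow> btw x (fst e) y \<and> btw y (snd e) x \<or> btw x (snd e) y \<and> btw y (fst e) x"
  unfolding separates_def using btw_interleave by blast

text \<open>Each edge crossing the chord xy has just one end on the open arc from x to y. Collecting
  only these ends bounds the set by \<open>crossings\<close> and not by twice that number.\<close>

definition cut_ends :: "(nat \<times> nat) set \<Rightarrow> nat \<Rightarrow> nat \<Rightarrow> nat set" where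
  "cut_ends E x y = {z. btw x z y \<and> (\<exists>e\<in>E. z = fst e \<and> btw y (snd e) x \<or> z = snd e \<and> btw y (fst e) x)}"

lemma card_cut_ends:
  assumes "finite E"
  shows "finite (cut_ends E x y) \<and> card (cut_ends E x y) \<le> crossings E x y"
proof -
  let ?g = "\<lambda>e. if btw x (fst e) y then fst e else snd e"
  have "cut_ends E x y \<subseteq> ?g ` {e\<in>E. separates e x y}"
  proof
    fix z assume "z \<in> cut_ends E x y"
    then obtain e where e: "btw x z y" "e \<in> E" "z = fst e \<and> btw y (snd e) x \<or> z = snd e \<and> btw y (fst e) x"
      unfolding cut_ends_def by blast
    then have "separates e x y" unfolding separates_iff by blast
    moreover have "?g e = z" using e btw_asym by auto
    ultimately show "z \<in> ?g ` {e\<in>E. separates e x y}" using e(2) by blast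
  qed
  moreover have fin: "finite {e\<in>E. separates e x y}" using assms by simp
  ultimately show ?thesis
    unfolding crossings_def using card_image_le[OF fin, of ?g] card_mono[of "?g ` {e\<in>E. separates e x y}" "cut_ends E x y"]
      finite_subset by fastforce
qed

lemma cut_ends_split:
  assumes "btw x v y"
  shows "cut_ends E x y \<subseteq> {v} \<union> cut_ends E x v \<union> cut_ends E v y"
proof
  fix z assume z: "z \<in> cut_ends E x y"
  have out: "btw v w x \<and> btw y w v" if "btw y w x" for w using that assms by (auto simp: btw_def)
  show "z \<in> {v} \<union> cut_ends E x v \<union> cut_ends E v y"
    using z btw_split[of x z y v] assms out unfolding cut_ends_def by blast
qed

text \<open>The separator of the chord xy: bags built on opposite sides of the chord may meet only
  inside it.\<close>

definition adhesion :: "(nat \<times> nat) set \<Rightarrow> nat \<Rightarrow> nat \<Rightarrow> nat set" where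
  "adhesion E x y = {x, y} \<union> cut_ends E x y \<union> cut_ends E y x"

definition triangle_bag :: "(nat \<times> nat) set \<Rightarrow> nat \<Rightarrow> nat \<Rightarrow> nat \<Rightarrow> nat set" where
  "triangle_bag E x v y = {x, v, y} \<union> cut_ends E x v \<union> cut_ends E v y \<union> cut_ends E y x"

lemma adhesion_subset_triangle_bag:
  assumes "btw x v y"
  shows "adhesion E x y \<subseteq> triangle_bag E x v y" "adhesion E x v \<subseteq> triangle_bag E x v y"
    "adhesion E v y \<subseteq> triangle_bag E x v y"
  using cut_ends_split[OF assms, of E] cut_ends_split[OF btw_rotate[OF assms], of E]
    cut_ends_split[OF btw_rotate[OF btw_rotate[OF assms]], of E]
  unfolding adhesion_def triangle_bag_def by blast+

lemma cut_ends_btw: "z \<in> cut_ends E x y \<Longrightarrow> btw x z y"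
  by (simp add: cut_ends_def)

text \<open>The open arcs cut off by the three sides are disjoint, so the position of z determines
  which part of the bag it comes from.\<close>

lemma triangle_bag_inside:
  assumes "btw x v y" "z \<in> triangle_bag E x v y"
  shows "btw x z v \<Longrightarrow> z \<in> cut_ends E x v" "btw v z y \<Longrightarrow> z \<in> cut_ends E v y"
proof -
  have d: "\<not> btw x w v" if "btw v w y \<or> btw y w x" for w using assms(1) that by (auto simp: btw_def)
  have d': "\<not> btw v w y" if "btw x w v \<or> btw y w x" for w using assms(1) that by (auto simp: btw_def)
  have e: "\<not> btw x x v" "\<not> btw x v v" "\<not> btw v v y" "\<not> btw v y y" using btw_distinct by blast+
  have f: "\<not> btw x y v" "\<not> btw v x y" using assms(1) by (auto simp: btw_def)
  show "btw x z v \<Longrightarrow> z \<in> cut_ends E x v"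
    using assms(2) d e f cut_ends_btw unfolding triangle_bag_def by blast
  show "btw v z y \<Longrightarrow> z \<in> cut_ends E v y"
    using assms(2) d' e f cut_ends_btw unfolding triangle_bag_def by blast
qed

locale chords =
  fixes n s :: nat and E :: "(nat \<times> nat) set"
  assumes E: "finite E" "\<And>e. e \<in> E \<Longrightarrow> fst e < n \<and> snd e < n"
begin

interpretation kalmanson "crossings E" s
  using kalmanson_crossings[OF E(1)] .

lemma cut_ends_less: "z \<in> cut_ends E x y \<Longrightarrow> z < n"
  using E(2) by (auto simp: cut_ends_def)

lemma card_triangle_bag:
  assumes "crossings E x v \<le> s" "crossings E v y \<le> s" "crossings E x y \<le> s"
  shows "card (triangle_bag E x v y) \<le> 3 + 3 * s"
proof -
  have "card (triangle_bag E x v y) \<le> card {x, v, y} + card (cut_ends E x v) + card (cut_ends E v y) + card (cut_ends E y x)"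
    unfolding triangle_bag_def by (meson card_Un_le add_le_mono1 le_trans)
  moreover have "card {x, v, y} \<le> 3" by (simp add: card_insert_if)
  moreover have "card (cut_ends E x v) \<le> s" "card (cut_ends E v y) \<le> s" "card (cut_ends E y x) \<le> s"
    using card_cut_ends[OF E(1)] assms c_sym[of y x] by (meson le_trans, meson le_trans, metis le_trans)
  ultimately show ?thesis by linarith
qed

text \<open>Hangs the triangles over the arc from x to y below node u. Earlier bags meet the open
  arc only inside the adhesion set, and new bags stay within the adhesion set and the arc. This
  keeps the running intersection property when the two sub-arcs are treated in turn.\<close>

lemma extend_decomposition:
  assumes "triang {..<n} x y" "crossings E x y \<le> s" "partial_decomposition N par B" "u < N" "adhesion E x y \<subseteq> B u"
    and "\<And>k z. k < N \<Longrightarrow> z \<in> B k \<Longrightarrow> btw x z y \<Longrightarrow> z \<in> adhesion E x y"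
  shows "\<exists>N' par' B'. partial_decomposition N' par' B' \<and> N \<le> N' \<and> (\<forall>k<N. B' k = B k)
    \<and> (\<forall>k. N \<le> k \<longrightarrow> k < N' \<longrightarrow> B' k \<subseteq> adhesion E x y \<union> {z. btw x z y} \<and> B' k \<subseteq> {..<n} \<and> card (B' k) \<le> 3 + 3 * s)
    \<and> (\<forall>v<n. btw x v y \<longrightarrow> (\<exists>k<N'. v \<in> B' k))
    \<and> (\<forall>e\<in>E. fst e \<in> {x, y} \<union> {z. btw x z y} \<longrightarrow> snd e \<in> {x, y} \<union> {z. btw x z y}
         \<longrightarrow> (\<exists>k<N'. fst e \<in> B' k \<and> snd e \<in> B' k))"
  using assms
proof (induction arbitrary: N par B u rule: triang.induct)
  case (side x y)
  have "\<exists>k<N. fst e \<in> B k \<and> snd e \<in> B k"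
    if "e \<in> E" "fst e \<in> {x, y} \<union> {z. btw x z y}" "snd e \<in> {x, y} \<union> {z. btw x z y}" for e
  proof -
    have "fst e \<in> {x, y}" "snd e \<in> {x, y}" using that side.hyps(4) E(2)[OF that(1)] by auto
    then have "fst e \<in> B u" "snd e \<in> B u" using side.prems(4) by (auto simp: adhesion_def)
    then show ?thesis using side.prems(3) by blast
  qed
  then show ?case using side.prems side.hyps
    by (intro exI[of _ N] exI[of _ par] exI[of _ B]) auto
next
  case (apex x v y)
  let ?W = "triangle_bag E x v y"
  note b = \<open>btw x v y\<close>
  have in_n: "x < n" "v < n" "y < n" using triang_in[OF apex.hyps(1)] triang_in[OF apex.hyps(2)] by auto
  have Wn: "?W \<subseteq> {..<n}" using in_n cut_ends_less by (auto simp: triangle_bag_def)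
  have adh: "adhesion E x y \<subseteq> ?W" "adhesion E x v \<subseteq> ?W" "adhesion E v y \<subseteq> ?W"
    using adhesion_subset_triangle_bag[OF b] by auto
  have Wsub: "?W \<subseteq> adhesion E x y \<union> {z. btw x z y}"
    using b cut_ends_btw btw_trans1[OF b] btw_trans2[OF b] unfolding triangle_bag_def adhesion_def by blast
  have old: "z \<in> B u" if "k < N" "z \<in> B k" "z \<in> ?W" for k z
    using that Wsub apex.prems(4) apex.prems(5)[OF that(1,2)] by blast
  define B0 where "B0 = B(N := ?W)"
  define par0 where "par0 = par(N := u)"
  have pd0: "partial_decomposition (N + 1) par0 B0"
    unfolding partial_decomposition_def
  proof (intro conjI allI impI)
    fix k assume k: "0 < k" "k < N + 1"
    show "par0 k < k" using k apex.prems(2,3) by (auto simp: par0_def partial_decomposition_def less_Suc_eq)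
    show "B0 k \<inter> (\<Union>j<k. B0 j) \<subseteq> B0 (par0 k)"
    proof (cases "k = N")
      case True
      then show ?thesis using old apex.prems(3) by (auto simp: B0_def par0_def)
    next
      case False
      then have "k < N" "par k < k" "B k \<inter> (\<Union>j<k. B j) \<subseteq> B (par k)"
        using k apex.prems(2) by (auto simp: partial_decomposition_def)
      then show ?thesis by (auto simp: B0_def par0_def)
    qed
  qed simp
  have in1: "z \<in> adhesion E x v" if "k < N + 1" "z \<in> B0 k" "btw x z v" for k z
  proof -
    have "z \<in> ?W"
    proof (cases "k = N")
      case False
      then have "z \<in> adhesion E x y" using that apex.prems(5)[of k z] btw_trans1[OF b that(3)] by (auto simp: B0_def)
      then show ?thesis using adh by blast
    qed (use that in \<open>simp add: B0_def\<close>)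
    then show ?thesis using triangle_bag_inside(1)[OF b _ that(3)] by (auto simp: adhesion_def)
  qed
  have "\<exists>N' par' B'. partial_decomposition N' par' B' \<and> N + 1 \<le> N' \<and> (\<forall>k<N + 1. B' k = B0 k)
    \<and> (\<forall>k. N + 1 \<le> k \<longrightarrow> k < N' \<longrightarrow> B' k \<subseteq> adhesion E x v \<union> {z. btw x z v} \<and> B' k \<subseteq> {..<n} \<and> card (B' k) \<le> 3 + 3 * s)
    \<and> (\<forall>w<n. btw x w v \<longrightarrow> (\<exists>k<N'. w \<in> B' k))
    \<and> (\<forall>e\<in>E. fst e \<in> {x, v} \<union> {z. btw x z v} \<longrightarrow> snd e \<in> {x, v} \<union> {z. btw x z v}
         \<longrightarrow> (\<exists>k<N'. fst e \<in> B' k \<and> snd e \<in> B' k))"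
  proof (rule apex.IH(1)[OF apex.hyps(4) pd0, of N])
    show "adhesion E x v \<subseteq> B0 N" using adh by (simp add: B0_def)
  qed (use in1 in auto)
  then obtain N1 par1 B1 where r1: "partial_decomposition N1 par1 B1" "N + 1 \<le> N1" "\<forall>k<N + 1. B1 k = B0 k"
    "\<forall>k. N + 1 \<le> k \<longrightarrow> k < N1 \<longrightarrow> B1 k \<subseteq> adhesion E x v \<union> {z. btw x z v} \<and> B1 k \<subseteq> {..<n} \<and> card (B1 k) \<le> 3 + 3 * s"
    "\<forall>w<n. btw x w v \<longrightarrow> (\<exists>k<N1. w \<in> B1 k)"
    "\<forall>e\<in>E. fst e \<in> {x, v} \<union> {z. btw x z v} \<longrightarrow> snd e \<in> {x, v} \<union> {z. btw x z v}
         \<longrightarrow> (\<exists>k<N1. fst e \<in> B1 k \<and> snd e \<in> B1 k)"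
    by (elim exE conjE)
  have disj: "\<not> btw x z v" if "btw v z y" for z using that b by (auto simp: btw_def)
  have in2: "z \<in> adhesion E v y" if k: "k < N1" "z \<in> B1 k" "btw v z y" for k z
  proof -
    have "z \<in> ?W"
    proof (cases "k < N + 1")
      case True
      then have "z \<in> B0 k" using r1(3) k by simp
      show ?thesis
      proof (cases "k = N")
        case False
        then have "z \<in> adhesion E x y"
          using \<open>z \<in> B0 k\<close> True apex.prems(5)[of k z] btw_trans2[OF b k(3)] by (auto simp: B0_def)
        then show ?thesis using adh by blast
      qed (use \<open>z \<in> B0 k\<close> in \<open>simp add: B0_def\<close>)
    next
      case False
      then have "B1 k \<subseteq> adhesion E x v \<union> {z. btw x z v}" using r1(4) k(1) by simp
      then show ?thesis using k(2) disj[OF k(3)] adh by blast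
    qed
    then show ?thesis using triangle_bag_inside(2)[OF b _ k(3)] by (auto simp: adhesion_def)
  qed
  have BN: "B1 N = ?W" using r1(3) by (simp add: B0_def)
  have "\<exists>N' par' B'. partial_decomposition N' par' B' \<and> N1 \<le> N' \<and> (\<forall>k<N1. B' k = B1 k)
    \<and> (\<forall>k. N1 \<le> k \<longrightarrow> k < N' \<longrightarrow> B' k \<subseteq> adhesion E v y \<union> {z. btw v z y} \<and> B' k \<subseteq> {..<n} \<and> card (B' k) \<le> 3 + 3 * s)
    \<and> (\<forall>w<n. btw v w y \<longrightarrow> (\<exists>k<N'. w \<in> B' k))
    \<and> (\<forall>e\<in>E. fst e \<in> {v, y} \<union> {z. btw v z y} \<longrightarrow> snd e \<in> {v, y} \<union> {z. btw v z y}
         \<longrightarrow> (\<exists>k<N'. fst e \<in> B' k \<and> snd e \<in> B' k))"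
  proof (rule apex.IH(2)[OF apex.hyps(5) r1(1), of N])
    show "N < N1" using r1(2) by simp
    show "adhesion E v y \<subseteq> B1 N" using adh BN by simp
  qed (rule in2)
  then obtain N2 par2 B2 where r2: "partial_decomposition N2 par2 B2" "N1 \<le> N2" "\<forall>k<N1. B2 k = B1 k"
    "\<forall>k. N1 \<le> k \<longrightarrow> k < N2 \<longrightarrow> B2 k \<subseteq> adhesion E v y \<union> {z. btw v z y} \<and> B2 k \<subseteq> {..<n} \<and> card (B2 k) \<le> 3 + 3 * s"
    "\<forall>w<n. btw v w y \<longrightarrow> (\<exists>k<N2. w \<in> B2 k)"
    "\<forall>e\<in>E. fst e \<in> {v, y} \<union> {z. btw v z y} \<longrightarrow> snd e \<in> {v, y} \<union> {z. btw v z y}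
         \<longrightarrow> (\<exists>k<N2. fst e \<in> B2 k \<and> snd e \<in> B2 k)"
    by (elim exE conjE)
  have lift: "B2 k = B1 k \<and> k < N2" if "k < N1" for k using that r2 by auto
  have B2N: "B2 N = ?W" "N < N2" using lift[of N] BN r1(2) by auto
  have card: "card ?W \<le> 3 + 3 * s" using card_triangle_bag apex by blast
  show ?case
  proof (rule exI[of _ N2], rule exI[of _ par2], rule exI[of _ B2], intro conjI allI impI ballI)
    show "partial_decomposition N2 par2 B2" by fact
    show "N \<le> N2" using r1(2) r2(2) by simp
    show "B2 k = B k" if "k < N" for k using that lift[of k] r1(2,3) by (simp add: B0_def)
  next
    fix k assume k: "N \<le> k" "k < N2"
    consider "k = N" | "N + 1 \<le> k" "k < N1" | "N1 \<le> k" using k by linarith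
    then show "B2 k \<subseteq> adhesion E x y \<union> {z. btw x z y}" "B2 k \<subseteq> {..<n}" "card (B2 k) \<le> 3 + 3 * s"
    proof (atomize (full), cases)
      case 1
      then show "B2 k \<subseteq> adhesion E x y \<union> {z. btw x z y} \<and> B2 k \<subseteq> {..<n} \<and> card (B2 k) \<le> 3 + 3 * s"
        using B2N Wsub Wn card by simp
    next
      case 2
      then have "B2 k \<subseteq> adhesion E x v \<union> {z. btw x z v}" "B2 k \<subseteq> {..<n} \<and> card (B2 k) \<le> 3 + 3 * s"
        using r1(4) lift[of k] by auto
      moreover have "{z. btw x z v} \<subseteq> {z. btw x z y}" using btw_trans1[OF b] by blast
      ultimately show "B2 k \<subseteq> adhesion E x y \<union> {z. btw x z y} \<and> B2 k \<subseteq> {..<n} \<and> card (B2 k) \<le> 3 + 3 * s"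
        using adh(2) Wsub by blast
    next
      case 3
      then have "B2 k \<subseteq> adhesion E v y \<union> {z. btw v z y}" "B2 k \<subseteq> {..<n} \<and> card (B2 k) \<le> 3 + 3 * s"
        using r2(4) k by auto
      moreover have "{z. btw v z y} \<subseteq> {z. btw x z y}" using btw_trans2[OF b] by blast
      ultimately show "B2 k \<subseteq> adhesion E x y \<union> {z. btw x z y} \<and> B2 k \<subseteq> {..<n} \<and> card (B2 k) \<le> 3 + 3 * s"
        using adh(3) Wsub by blast
    qed
  next
    fix w assume w: "w < n" "btw x w y"
    then consider "w = v" | "btw x w v" | "btw v w y" using btw_split[OF w(2) b] by blast
    then show "\<exists>k<N2. w \<in> B2 k"
    proof cases
      case 1 then show ?thesis using B2N by (auto simp: triangle_bag_def)
    next
      case 2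
      then obtain k where "k < N1" "w \<in> B1 k" using r1(5) w by blast
      then show ?thesis using lift[of k] by auto
    next
      case 3 then show ?thesis using r2(5) w by blast
    qed
  next
    fix e assume e: "e \<in> E" "fst e \<in> {x, y} \<union> {z. btw x z y}" "snd e \<in> {x, y} \<union> {z. btw x z y}"
    let ?L = "{x, v} \<union> {z. btw x z v}" and ?R = "{v, y} \<union> {z. btw v z y}"
    have part: "w \<in> ?L \<or> w \<in> ?R" if "w \<in> {x, y} \<union> {z. btw x z y}" for w
      using that btw_split[of x w y v] b by blast
    \<comment> \<open>An end that is neither x nor y is cut off from the other end by the chord xv
      or vy below which it lies, and thus belongs to the \<open>cut_ends\<close> of that
      chord.\<close>
    have cut: "p \<in> ?W \<and> q \<in> ?W"
      if pq: "p \<in> ?L" "p \<notin> ?R" "q \<in> ?R" "q \<notin> ?L" "e = (p, q) \<or> e = (q, p)" for p q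
    proof
      have p: "p = x \<or> btw x p v" and q: "q = y \<or> btw v q y" using pq by auto
      have vq: "btw v q x" using q btw_rotate[OF b] btw_trans1[OF btw_rotate[OF b]] by blast
      have yp: "btw y p v"
        using p btw_rotate[OF btw_rotate[OF b]] btw_trans2[OF btw_rotate[OF btw_rotate[OF b]]] by blast
      show "p \<in> ?W"
      proof (cases "p = x")
        case False
        then have "btw x p v" using p by simp
        then have "p \<in> cut_ends E x v" using vq pq(5) e(1) unfolding cut_ends_def by force
        then show ?thesis by (simp add: triangle_bag_def)
      qed (simp add: triangle_bag_def)
      show "q \<in> ?W"
      proof (cases "q = y")
        case False
        then have "btw v q y" using q by simp
        then have "q \<in> cut_ends E v y" using yp pq(5) e(1) unfolding cut_ends_def by force
        then show ?thesis by (simp add: triangle_bag_def)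
      qed (simp add: triangle_bag_def)
    qed
    consider "fst e \<in> ?L" "snd e \<in> ?L" | "fst e \<in> ?R" "snd e \<in> ?R"
      | "fst e \<in> ?L" "fst e \<notin> ?R" "snd e \<in> ?R" "snd e \<notin> ?L"
      | "snd e \<in> ?L" "snd e \<notin> ?R" "fst e \<in> ?R" "fst e \<notin> ?L"
      using part e by blast
    then show "\<exists>k<N2. fst e \<in> B2 k \<and> snd e \<in> B2 k"
    proof cases
      case 1
      then obtain k where "k < N1" "fst e \<in> B1 k" "snd e \<in> B1 k" using r1(6) e(1) by blast
      then show ?thesis using lift[of k] by auto
    next
      case 2 then show ?thesis using r2(6) e(1) by blast
    next
      case 3 then show ?thesis using cut[of "fst e" "snd e"] B2N by auto
    next
      case 4 then show ?thesis using cut[of "snd e" "fst e"] B2N by auto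
    qed
  qed
qed

theorem triangulable_imp_decomposition:
  assumes "triangulable {..<n}"
  shows "\<exists>N par B. partial_decomposition N par B \<and> (\<forall>k<N. B k \<subseteq> {..<n} \<and> card (B k) \<le> 3 + 3 * s)
    \<and> (\<forall>v<n. \<exists>k<N. v \<in> B k) \<and> (\<forall>e\<in>E. \<exists>k<N. fst e \<in> B k \<and> snd e \<in> B k)"
proof -
  obtain x y where xy: "crossings E x y \<le> s" "triang {..<n} x y" "triang {..<n} y x"
    using assms by (auto simp: triangulable_def)
  have n: "x < n" "y < n" "x \<noteq> y" using triang_in[OF xy(2)] by auto
  have yx: "crossings E y x \<le> s" using xy c_sym by simp
  \<comment> \<open>The root node carries the separator of the root chord, and the triangulations of
    both arcs are hung below it.\<close>
  define B0 where "B0 = (\<lambda>_::nat. adhesion E x y)"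
  have adh: "adhesion E y x = adhesion E x y" by (auto simp: adhesion_def)
  have pd0: "partial_decomposition 1 (\<lambda>_. 0) B0" by (simp add: partial_decomposition_def)
  have "card (adhesion E x y) \<le> card {x, y} + card (cut_ends E x y) + card (cut_ends E y x)"
    unfolding adhesion_def by (meson card_Un_le add_le_mono1 le_trans)
  moreover have "card {x, y} \<le> 2" by (simp add: card_insert_if)
  moreover have "card (cut_ends E x y) \<le> s" "card (cut_ends E y x) \<le> s"
    using card_cut_ends[OF E(1)] xy(1) yx by (meson le_trans)+
  ultimately have card0: "card (adhesion E x y) \<le> 3 + 3 * s" by linarith
  have adhn: "adhesion E x y \<subseteq> {..<n}" using n cut_ends_less by (auto simp: adhesion_def)
  have "\<exists>N' par' B'. partial_decomposition N' par' B' \<and> 1 \<le> N' \<and> (\<forall>k<1. B' k = B0 k)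
    \<and> (\<forall>k. 1 \<le> k \<longrightarrow> k < N' \<longrightarrow> B' k \<subseteq> adhesion E x y \<union> {z. btw x z y} \<and> B' k \<subseteq> {..<n} \<and> card (B' k) \<le> 3 + 3 * s)
    \<and> (\<forall>v<n. btw x v y \<longrightarrow> (\<exists>k<N'. v \<in> B' k))
    \<and> (\<forall>e\<in>E. fst e \<in> {x, y} \<union> {z. btw x z y} \<longrightarrow> snd e \<in> {x, y} \<union> {z. btw x z y}
         \<longrightarrow> (\<exists>k<N'. fst e \<in> B' k \<and> snd e \<in> B' k))"
    by (rule extend_decomposition[OF xy(2,1) pd0, of 0]) (auto simp: B0_def)
  then obtain N1 par1 B1 where r1: "partial_decomposition N1 par1 B1" "1 \<le> N1" "\<forall>k<1. B1 k = B0 k"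
    "\<forall>k. 1 \<le> k \<longrightarrow> k < N1 \<longrightarrow> B1 k \<subseteq> adhesion E x y \<union> {z. btw x z y} \<and> B1 k \<subseteq> {..<n} \<and> card (B1 k) \<le> 3 + 3 * s"
    "\<forall>v<n. btw x v y \<longrightarrow> (\<exists>k<N1. v \<in> B1 k)"
    "\<forall>e\<in>E. fst e \<in> {x, y} \<union> {z. btw x z y} \<longrightarrow> snd e \<in> {x, y} \<union> {z. btw x z y}
         \<longrightarrow> (\<exists>k<N1. fst e \<in> B1 k \<and> snd e \<in> B1 k)"
    by (elim exE conjE)
  have B10: "B1 0 = adhesion E x y" using r1(3) by (simp add: B0_def)
  have in2: "z \<in> adhesion E y x" if "k < N1" "z \<in> B1 k" "btw y z x" for k z
  proof (cases "k = 0")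
    case True then show ?thesis using that B10 adh by simp
  next
    case False
    then have "B1 k \<subseteq> adhesion E x y \<union> {z. btw x z y}" using r1(4) that(1) by simp
    then show ?thesis using that btw_asym adh by blast
  qed
  have "\<exists>N' par' B'. partial_decomposition N' par' B' \<and> N1 \<le> N' \<and> (\<forall>k<N1. B' k = B1 k)
    \<and> (\<forall>k. N1 \<le> k \<longrightarrow> k < N' \<longrightarrow> B' k \<subseteq> adhesion E y x \<union> {z. btw y z x} \<and> B' k \<subseteq> {..<n} \<and> card (B' k) \<le> 3 + 3 * s)
    \<and> (\<forall>v<n. btw y v x \<longrightarrow> (\<exists>k<N'. v \<in> B' k))
    \<and> (\<forall>e\<in>E. fst e \<in> {y, x} \<union> {z. btw y z x} \<longrightarrow> snd e \<in> {y, x} \<union> {z. btw y z x}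
         \<longrightarrow> (\<exists>k<N'. fst e \<in> B' k \<and> snd e \<in> B' k))"
    by (rule extend_decomposition[OF xy(3) yx r1(1), of 0]) (use r1(2) B10 adh in2 in auto)
  then obtain N2 par2 B2 where r2: "partial_decomposition N2 par2 B2" "N1 \<le> N2" "\<forall>k<N1. B2 k = B1 k"
    "\<forall>k. N1 \<le> k \<longrightarrow> k < N2 \<longrightarrow> B2 k \<subseteq> adhesion E y x \<union> {z. btw y z x} \<and> B2 k \<subseteq> {..<n} \<and> card (B2 k) \<le> 3 + 3 * s"
    "\<forall>v<n. btw y v x \<longrightarrow> (\<exists>k<N2. v \<in> B2 k)"
    "\<forall>e\<in>E. fst e \<in> {y, x} \<union> {z. btw y z x} \<longrightarrow> snd e \<in> {y, x} \<union> {z. btw y z x}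
         \<longrightarrow> (\<exists>k<N2. fst e \<in> B2 k \<and> snd e \<in> B2 k)"
    by (elim exE conjE)
  have lift: "B2 k = B1 k \<and> k < N2" if "k < N1" for k using that r2(2,3) by auto
  have B20: "B2 0 = adhesion E x y" "0 < N2" using lift[of 0] r1(2) B10 by auto
  have tot: "w = x \<or> w = y \<or> btw x w y \<or> btw y w x" for w using btw_total[of x w y] n(3) by metis
  show ?thesis
  proof (rule exI[of _ N2], rule exI[of _ par2], rule exI[of _ B2], intro conjI allI impI ballI)
    show "partial_decomposition N2 par2 B2" by fact
    fix k assume k: "k < N2"
    consider "k = 0" | "1 \<le> k" "k < N1" | "N1 \<le> k" by linarith
    then show "B2 k \<subseteq> {..<n}" "card (B2 k) \<le> 3 + 3 * s"
    proof (atomize (full), cases)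
      case 1 then show "B2 k \<subseteq> {..<n} \<and> card (B2 k) \<le> 3 + 3 * s" using B20 adhn card0 by simp
    next
      case 2 then show "B2 k \<subseteq> {..<n} \<and> card (B2 k) \<le> 3 + 3 * s" using r1(4) lift[of k] by simp
    next
      case 3 then show "B2 k \<subseteq> {..<n} \<and> card (B2 k) \<le> 3 + 3 * s" using r2(4) k by simp
    qed
  next
    fix v assume v: "v < n"
    consider "v = x \<or> v = y" | "btw x v y" | "btw y v x" using tot[of v] by blast
    then show "\<exists>k<N2. v \<in> B2 k"
    proof cases
      case 1 then show ?thesis using B20 by (auto simp: adhesion_def)
    next
      case 2
      then obtain k where "k < N1" "v \<in> B1 k" using r1(5) v by blast
      then show ?thesis using lift[of k] by auto
    next
      case 3 then show ?thesis using r2(5) v by blast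
    qed
  next
    fix e assume e: "e \<in> E"
    let ?L = "{x, y} \<union> {z. btw x z y}" and ?R = "{y, x} \<union> {z. btw y z x}"
    have cut: "p \<in> adhesion E x y \<and> q \<in> adhesion E x y" if "btw x p y" "btw y q x" "e = (p, q) \<or> e = (q, p)" for p q
    proof -
      have "p \<in> cut_ends E x y" "q \<in> cut_ends E y x" using that e unfolding cut_ends_def by force+
      then show ?thesis by (simp add: adhesion_def)
    qed
    consider "fst e \<in> ?L" "snd e \<in> ?L" | "fst e \<in> ?R" "snd e \<in> ?R" | "btw x (fst e) y" "btw y (snd e) x"
      | "btw x (snd e) y" "btw y (fst e) x"
      using tot[of "fst e"] tot[of "snd e"] by blast
    then show "\<exists>k<N2. fst e \<in> B2 k \<and> snd e \<in> B2 k"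
    proof cases
      case 1
      then obtain k where "k < N1" "fst e \<in> B1 k" "snd e \<in> B1 k" using r1(6) e by blast
      then show ?thesis using lift[of k] by auto
    next
      case 2 then show ?thesis using r2(6) e by blast
    next
      case 3 then show ?thesis using cut[of "fst e" "snd e"] B20 by auto
    next
      case 4 then show ?thesis using cut[of "snd e" "fst e"] B20 by auto
    qed
  qed
qed

end

subsection \<open>Subdivisions of complete graphs\<close>

fun path_arcs :: "'a \<Rightarrow> 'a list \<Rightarrow> 'a \<Rightarrow> ('a \<times> 'a) set" where
  "path_arcs u [] v = {(u, v), (v, u)}"
| "path_arcs u (w # ws) v = {(u, w), (w, u)} \<union> path_arcs w ws v"

text \<open>The first inner vertex w subdivides the arc (u, v), and the rest of the path goes into
  the new arc (w, v).\<close>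

lemma subdivide_along_path:
  assumes "subdivision_pair K H" "(u, v) \<in> parcs H" "distinct ws" "set ws \<inter> pverts H = {}"
  shows "\<exists>H'. subdivision_pair K H' \<and> pverts H' = pverts H \<union> set ws
    \<and> parcs H' = parcs H - {(u, v), (v, u)} \<union> path_arcs u ws v"
  using assms
proof (induction ws arbitrary: u H)
  case Nil
  interpret H: pair_bidirected_digraph H using Nil(1) by (rule bidirected_digraphI_subdivision)
  have "(v, u) \<in> parcs H" using Nil(2) H.arcs_symmetric by blast
  then show ?case using Nil by (intro exI[of _ H]) auto
next
  case (Cons w ws)
  interpret H: pair_bidirected_digraph H using Cons.prems(1) by (rule bidirected_digraphI_subdivision)
  let ?H1 = "subdivide H (u, v) w"
  have w: "w \<notin> pverts H" using Cons.prems by auto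
  have no: "(w, v) \<notin> parcs H" "(v, w) \<notin> parcs H"
    using w H.arc_fst_in_verts H.arc_snd_in_verts by force+
  have uv: "u \<in> pverts H" "v \<in> pverts H"
    using H.arc_fst_in_verts H.arc_snd_in_verts Cons.prems(2) by force+
  have "subdivision_pair K ?H1" using Cons.prems w by (intro subdivision_pair_divide)
  moreover have "(w, v) \<in> parcs ?H1" by simp
  moreover have "set ws \<inter> pverts ?H1 = {}" using Cons.prems by auto
  ultimately obtain H' where H': "subdivision_pair K H'" "pverts H' = pverts ?H1 \<union> set ws"
    "parcs H' = parcs ?H1 - {(w, v), (v, w)} \<union> path_arcs w ws v"
    using Cons.IH[of ?H1 w] Cons.prems(3) by auto
  have "u \<noteq> w" "v \<noteq> w" "u \<noteq> v" using uv w H.pair_no_loops[OF Cons.prems(2)] by auto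
  then have "parcs H' = parcs H - {(u, v), (v, u)} \<union> path_arcs u (w # ws) v"
    using H'(3) no by auto
  then show ?case using H' by (intro exI[of _ H']) auto
qed

lemma distinct_path_exists:
  assumes "(x, y) \<in> R\<^sup>*"
  shows "\<exists>ws. ws \<noteq> [] \<and> hd ws = x \<and> last ws = y \<and> distinct ws \<and> successively (\<lambda>a b. (a, b) \<in> R) ws"
  using assms
proof induction
  case base
  show ?case by (intro exI[of _ "[x]"]) simp
next
  case (step y z)
  then obtain ws where ws: "ws \<noteq> []" "hd ws = x" "last ws = y" "distinct ws"
    "successively (\<lambda>a b. (a, b) \<in> R) ws" by blast
  show ?case
  proof (cases "z \<in> set ws")
    case True
    then obtain as bs where "ws = as @ z # bs" by (meson split_list)
    then have "ws = (as @ [z]) @ bs" by simp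
    then show ?thesis using ws by (intro exI[of _ "as @ [z]"]) (auto simp: successively_append_iff hd_append)
  next
    case False
    then show ?thesis using ws step(2) by (intro exI[of _ "ws @ [z]"]) (auto simp: successively_append_iff)
  qed
qed

lemma path_arcs_subset:
  assumes "ws \<noteq> []" "successively (\<lambda>a b. (a, b) \<in> A) ws" "(u, hd ws) \<in> A" "(last ws, v) \<in> A" "sym A"
  shows "path_arcs u ws v \<subseteq> A"
  using assms
proof (induction ws arbitrary: u)
  case (Cons w ws)
  then show ?case by (cases ws) (auto dest: symD)
qed simp

theorem topological_complete_minorI:
  fixes X :: "'a pair_pre_digraph"
  assumes X: "pair_wf_digraph X" "sym (parcs X)"
    and B: "B \<subseteq> pverts X" "finite B" "card B = t"
    and C: "\<And>i. i < t choose 2 \<Longrightarrow> C i \<subseteq> pverts X - B"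
    "\<And>i j. i < t choose 2 \<Longrightarrow> j < t choose 2 \<Longrightarrow> i \<noteq> j \<Longrightarrow> C i \<inter> C j = {}"
    "\<And>i e f. i < t choose 2 \<Longrightarrow> e \<in> C i \<Longrightarrow> f \<in> C i \<Longrightarrow> (e, f) \<in> {(g, h). g \<in> C i \<and> h \<in> C i \<and> (g, h) \<in> parcs X}\<^sup>*"
    "\<And>i b. i < t choose 2 \<Longrightarrow> b \<in> B \<Longrightarrow> \<exists>f\<in>C i. (b, f) \<in> parcs X"
  shows "has_topological_complete_minor t X"
proof -
  define P where "P = {p. p \<subseteq> B \<and> card p = 2}"
  have finP: "finite P" and cardP: "card P = t choose 2"
    using B n_subsets[of B 2] by (auto simp: P_def)
  obtain idx where idx: "bij_betw idx P {..<t choose 2}"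
    using finP cardP by (metis atLeast0LessThan ex_bij_betw_finite_nat)
  have idx_less: "idx p < t choose 2" if "p \<in> P" for p using idx that by (auto simp: bij_betw_def)
  define K where "K = \<lparr>pverts = B, parcs = {(u, v). u \<in> B \<and> v \<in> B \<and> u \<noteq> v}\<rparr>"
  have K: "complete_digraph t (with_proj K)"
    unfolding complete_digraph_pair_def using B by (auto simp: K_def)
  have path: "\<exists>u v ws. p = {u, v} \<and> u \<noteq> v \<and> distinct ws \<and> set ws \<subseteq> C (idx p) \<and> path_arcs u ws v \<subseteq> parcs X"
    if p: "p \<in> P" for p
  proof -
    let ?R = "{(g, h). g \<in> C (idx p) \<and> h \<in> C (idx p) \<and> (g, h) \<in> parcs X}"
    obtain u v where uv: "p = {u, v}" "u \<noteq> v" using p by (auto simp: P_def card_2_iff)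
    then have "u \<in> B" "v \<in> B" using p by (auto simp: P_def)
    then obtain f g where fg: "f \<in> C (idx p)" "(u, f) \<in> parcs X" "g \<in> C (idx p)" "(v, g) \<in> parcs X"
      using C(4)[OF idx_less[OF p]] by blast
    obtain ws where ws: "ws \<noteq> []" "hd ws = f" "last ws = g" "distinct ws" "successively (\<lambda>a b. (a, b) \<in> ?R) ws"
      using distinct_path_exists[OF C(3)[OF idx_less[OF p] fg(1,3)]] by blast
    have "set ws \<subseteq> C (idx p)"
      using ws(1,2,5) fg(1)
    proof (induction ws arbitrary: f)
      case (Cons a ws)
      then show ?case by (cases ws) auto
    qed simp
    moreover have "path_arcs u ws v \<subseteq> parcs X"
    proof (rule path_arcs_subset)
      show "successively (\<lambda>a b. (a, b) \<in> parcs X) ws"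
        using ws(5) by (rule successively_mono) auto
    qed (use ws fg X(2) in \<open>auto dest: symD\<close>)
    ultimately show ?thesis using uv ws(4) by blast
  qed
  \<comment> \<open>Paths are inserted pair by pair. Pairs outside Q are still joined by arcs of K,
    which need not lie in X; for \<open>Q = P\<close> none of these remain.\<close>
  have "\<exists>H. subdivision_pair K H \<and> pverts H \<subseteq> B \<union> (\<Union>p\<in>Q. C (idx p))
      \<and> {(u, v) \<in> parcs K. {u, v} \<notin> Q} \<subseteq> parcs H \<and> parcs H \<subseteq> {(u, v) \<in> parcs K. {u, v} \<notin> Q} \<union> parcs X"
    if "Q \<subseteq> P" for Q
    using finite_subset[OF that finP] that
  proof (induction Q rule: finite_induct)
    case empty
    interpret K: pair_graph K using K by (rule pair_graphI_complete)
    have "pair_bidirected_digraph K" by unfold_locales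
    then have "subdivision_pair K K" by (rule subdivision_pair_base)
    moreover have "pverts K = B" by (simp add: K_def)
    ultimately show ?case by (intro exI[of _ K]) auto
  next
    case (insert p Q)
    then obtain H where H: "subdivision_pair K H" "pverts H \<subseteq> B \<union> (\<Union>p\<in>Q. C (idx p))"
      "{(u, v) \<in> parcs K. {u, v} \<notin> Q} \<subseteq> parcs H" "parcs H \<subseteq> {(u, v) \<in> parcs K. {u, v} \<notin> Q} \<union> parcs X"
      by auto
    have p: "p \<in> P" using insert by simp
    obtain u v ws where w: "p = {u, v}" "u \<noteq> v" "distinct ws" "set ws \<subseteq> C (idx p)" "path_arcs u ws v \<subseteq> parcs X"
      using path[OF p] by blast
    have "(u, v) \<in> parcs K" using w p by (auto simp: K_def P_def)
    then have "(u, v) \<in> parcs H" using H(3) w(1) insert.hyps(2) by auto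
    moreover have "set ws \<inter> pverts H = {}"
    proof -
      have "C (idx p) \<inter> C (idx q) = {}" if "q \<in> Q" for q
      proof (rule C(2))
        have "q \<in> P" "q \<noteq> p" using that insert by auto
        then show "idx p \<noteq> idx q" using idx p unfolding bij_betw_def inj_on_def by blast
        show "idx p < t choose 2" "idx q < t choose 2" using idx_less p \<open>q \<in> P\<close> by auto
      qed
      moreover have "C (idx p) \<inter> B = {}" using C(1)[OF idx_less[OF p]] by blast
      ultimately show ?thesis using w(4) H(2) by blast
    qed
    ultimately obtain H' where H': "subdivision_pair K H'" "pverts H' = pverts H \<union> set ws"
      "parcs H' = parcs H - {(u, v), (v, u)} \<union> path_arcs u ws v"
      using subdivide_along_path[OF H(1) _ w(3)] by blast
    have "{(a, b) \<in> parcs K. {a, b} \<notin> insert p Q} \<subseteq> parcs H'" using H(3) H'(3) w(1) by auto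
    moreover have "parcs H' \<subseteq> {(a, b) \<in> parcs K. {a, b} \<notin> insert p Q} \<union> parcs X"
    proof
      fix e assume e: "e \<in> parcs H'"
      obtain a b where ab: "e = (a, b)" by (cases e)
      show "e \<in> {(a, b) \<in> parcs K. {a, b} \<notin> insert p Q} \<union> parcs X"
      proof (cases "e \<in> path_arcs u ws v")
        case True
        then show ?thesis using w(5) by blast
      next
        case False
        then have "e \<in> parcs H" "e \<noteq> (u, v)" "e \<noteq> (v, u)" using e H'(3) by auto
        then show ?thesis using H(4) ab w(1) by (auto simp: doubleton_eq_iff)
      qed
    qed
    ultimately show ?case using H' H(2) w(4) by (intro exI[of _ H']) auto
  qed
  from this[of P] obtain H where H: "subdivision_pair K H" "pverts H \<subseteq> B \<union> (\<Union>p\<in>P. C (idx p))"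
    "parcs H \<subseteq> {(u, v) \<in> parcs K. {u, v} \<notin> P} \<union> parcs X" by auto
  have "{(u, v) \<in> parcs K. {u, v} \<notin> P} = {}" by (auto simp: K_def P_def card_2_iff)
  then have arcs: "parcs H \<subseteq> parcs X" using H(3) by blast
  have verts: "pverts H \<subseteq> pverts X" using H(2) B(1) C(1)[OF idx_less] by blast
  interpret H: pair_bidirected_digraph H using H(1) by (rule bidirected_digraphI_subdivision)
  interpret X: pair_wf_digraph X by (rule X)
  have "subgraph (with_proj H) (with_proj X)"
    unfolding subgraph_def compatible_def using arcs verts H.wf_digraph X.wf_digraph by simp
  then show ?thesis
    unfolding has_topological_complete_minor_def using H(1) K by blast
qed

subsection \<open>Chords of a circle\<close>

text \<open>Twice the signed area of the triangle abc, positive if it is oriented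
  counterclockwise.\<close>

definition det3 :: "complex \<Rightarrow> complex \<Rightarrow> complex \<Rightarrow> real" where
  "det3 a b c = (Re b - Re a) * (Im c - Im a) - (Im b - Im a) * (Re c - Re a)"

text \<open>Four points of the plane satisfy an affine dependency whose coefficients are the signed areas of
  the triangles they span; it exhibits the intersection point of the diagonals.\<close>

lemma segments_cross:
  assumes "det3 b c d > 0" "det3 a c d > 0" "det3 a b d > 0" "det3 a b c > 0"
  shows "\<exists>p \<in> closed_segment a c \<inter> closed_segment b d. p \<notin> {a, c} \<and> p \<notin> {b, d}"
proof -
  define A B C D where "A = det3 b c d" and "B = det3 a c d" and "C = det3 a b d" and "D = det3 a b c"
  note defs = A_def B_def C_def D_def
  have pos: "A > 0" "B > 0" "C > 0" "D > 0" using assms by (auto simp: defs)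
  have sum: "A + C = B + D" unfolding defs det3_def by (simp add: algebra_simps)
  have re: "A * Re a + C * Re c = B * Re b + D * Re d" unfolding defs det3_def by (simp add: algebra_simps)
  have im: "A * Im a + C * Im c = B * Im b + D * Im d" unfolding defs det3_def by (simp add: algebra_simps)
  have vec: "A *\<^sub>R a + C *\<^sub>R c = B *\<^sub>R b + D *\<^sub>R d" using re im by (simp add: complex_eq_iff)
  define t where "t = C / (A + C)"
  define u where "u = D / (B + D)"
  have t: "0 < t" "t < 1" "1 - t = A / (A + C)" using pos by (auto simp: t_def field_simps)
  have u: "0 < u" "u < 1" "1 - u = B / (A + C)" "u = D / (A + C)" using pos sum by (auto simp: u_def field_simps)
  have "(1 - t) *\<^sub>R a + t *\<^sub>R c = (1 / (A + C)) *\<^sub>R (A *\<^sub>R a + C *\<^sub>R c)"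
    unfolding t(3) by (simp add: t_def scaleR_add_right)
  also have "\<dots> = (1 - u) *\<^sub>R b + u *\<^sub>R d"
    unfolding vec u(3) unfolding u(4) by (simp add: scaleR_add_right)
  finally have eq: "(1 - t) *\<^sub>R a + t *\<^sub>R c = (1 - u) *\<^sub>R b + u *\<^sub>R d" .
  define p where "p = (1 - t) *\<^sub>R a + t *\<^sub>R c"
  have "a \<noteq> c" using pos(4) by (auto simp: defs det3_def)
  moreover have "b \<noteq> d" using pos(3) by (auto simp: defs det3_def algebra_simps)
  ultimately have "p \<in> open_segment a c" "p \<in> open_segment b d"
    using t u eq unfolding in_segment p_def by blast+
  then show ?thesis unfolding open_segment_def by blast
qed

text \<open>With h half the sum of x and y, both sides are \<open>2 * sin h\<close> times a cosine,
  and the cosine decreases from \<open>\<bar>x - y\<bar> / 2\<close> to h.\<close>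

lemma sin_add_less:
  assumes "0 < x" "0 < y" "x + y < 2 * pi"
  shows "sin (x + y) < sin x + sin (y :: real)"
proof -
  define h where "h = (x + y) / 2"
  have h: "0 < h" "h < pi" using assms by (auto simp: h_def)
  have "cos h < cos \<bar>(x - y) / 2\<bar>"
    using assms h by (intro cos_monotone_0_pi) (auto simp: h_def)
  then have "cos h < cos ((x - y) / 2)" by (metis cos_abs_real)
  moreover have "sin h > 0" using h by (rule sin_gt_zero)
  ultimately have "2 * sin h * cos h < 2 * sin h * cos ((x - y) / 2)" by simp
  moreover have "x + y = 2 * h" by (simp add: h_def)
  then have "sin (x + y) = 2 * sin h * cos h" by (simp only: sin_double)
  moreover have "sin x + sin y = 2 * sin h * cos ((x - y) / 2)" by (simp add: sin_plus_sin h_def)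
  ultimately show ?thesis by simp
qed

lemma det3_circle_pos:
  assumes "r > 0" "\<alpha> < \<beta>" "\<beta> < \<gamma>" "\<gamma> - \<alpha> < 2 * pi"
  shows "det3 (z + of_real r * cis \<alpha>) (z + of_real r * cis \<beta>) (z + of_real r * cis \<gamma>) > 0"
proof -
  have "det3 (z + of_real r * cis \<alpha>) (z + of_real r * cis \<beta>) (z + of_real r * cis \<gamma>)
      = r ^ 2 * (sin (\<beta> - \<alpha>) + sin (\<gamma> - \<beta>) - sin ((\<beta> - \<alpha>) + (\<gamma> - \<beta>)))"
    by (simp add: det3_def sin_diff algebra_simps power2_eq_square)
  moreover have "sin ((\<beta> - \<alpha>) + (\<gamma> - \<beta>)) < sin (\<beta> - \<alpha>) + sin (\<gamma> - \<beta>)"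
    using assms by (intro sin_add_less) auto
  ultimately show ?thesis using assms(1) by simp
qed

text \<open>Vertices are sorted by their angle at the centre. Values of \<open>Arg\<close> differ by
  less than a full turn, so four vertices in this order make all determinants in
  \<open>segments_cross\<close> positive.\<close>

lemma circular_drawing_order:
  assumes "circular_drawing G pos" "finite (pverts G)"
  obtains vert where "bij_betw vert {..<card (pverts G)} (pverts G)"
    "\<And>a b c d. a < b \<Longrightarrow> b < c \<Longrightarrow> c < d \<Longrightarrow> d < card (pverts G)
       \<Longrightarrow> edges_cross pos {vert a, vert c} {vert b, vert d}"
proof -
  let ?V = "pverts G" and ?n = "card (pverts G)"
  obtain z r where inj: "inj_on pos ?V" and r: "r > 0" and sph: "pos ` ?V \<subseteq> sphere z r"
    using assms(1) by (auto simp: circular_drawing_def)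
  define \<theta> where "\<theta> v = Arg (pos v - z)" for v
  have pos_eq: "pos v = z + of_real r * cis (\<theta> v)" if "v \<in> ?V" for v
  proof -
    have "cmod (pos v - z) = r" using sph that by (auto simp: dist_norm norm_minus_commute)
    then show ?thesis using rcis_cmod_Arg[of "pos v - z"] by (simp add: \<theta>_def rcis_def)
  qed
  have inj\<theta>: "inj_on \<theta> ?V"
    using inj pos_eq unfolding inj_on_def by metis
  define xs where "xs = sorted_list_of_set (\<theta> ` ?V)"
  have xs: "set xs = \<theta> ` ?V" "sorted xs" "distinct xs" "length xs = ?n"
    using assms(2) card_image[OF inj\<theta>] by (auto simp: xs_def)
  define vert where "vert i = inv_into ?V \<theta> (xs ! i)" for i
  have \<theta>v: "\<theta> (vert i) = xs ! i" "vert i \<in> ?V" if "i < ?n" for i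
  proof -
    have "xs ! i \<in> \<theta> ` ?V" using xs that by (metis nth_mem)
    then show "\<theta> (vert i) = xs ! i" "vert i \<in> ?V" unfolding vert_def by (auto intro: f_inv_into_f inv_into_into)
  qed
  have less: "\<theta> (vert i) < \<theta> (vert j)" if "i < j" "j < ?n" for i j
  proof -
    have "xs ! i < xs ! j" using xs(2,3,4) that
      by (metis distinct_conv_nth less_trans nat_less_le order_less_le sorted_nth_mono)
    then show ?thesis using \<theta>v that by simp
  qed
  have "inj_on vert {..<?n}" using less by (metis inj_onI lessThan_iff linorder_neqE_nat less_irrefl)
  moreover have "vert ` {..<?n} \<subseteq> ?V" using \<theta>v by auto
  ultimately have bij: "bij_betw vert {..<?n} ?V"
    using assms(2) by (metis bij_betw_def card_image card_lessThan card_subset_eq)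
  have "edges_cross pos {vert a, vert c} {vert b, vert d}"
    if ord: "a < b" "b < c" "c < d" "d < ?n" for a b c d
  proof -
    have range: "\<theta> v - \<theta> w < 2 * pi" for v w
      using Arg_bounded[of "pos v - z"] Arg_bounded[of "pos w - z"] by (simp add: \<theta>_def)
    have V: "vert a \<in> ?V" "vert b \<in> ?V" "vert c \<in> ?V" "vert d \<in> ?V" using \<theta>v ord by auto
    have l: "\<theta> (vert a) < \<theta> (vert b)" "\<theta> (vert b) < \<theta> (vert c)" "\<theta> (vert c) < \<theta> (vert d)"
      "\<theta> (vert a) < \<theta> (vert c)" "\<theta> (vert b) < \<theta> (vert d)"
      using less ord by auto
    have "\<exists>p \<in> closed_segment (pos (vert a)) (pos (vert c)) \<inter> closed_segment (pos (vert b)) (pos (vert d)).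
        p \<notin> {pos (vert a), pos (vert c)} \<and> p \<notin> {pos (vert b), pos (vert d)}"
      by (rule segments_cross; unfold pos_eq[OF V(1)] pos_eq[OF V(2)] pos_eq[OF V(3)] pos_eq[OF V(4)];
          rule det3_circle_pos[OF r]; use l range in blast)
    moreover have "{vert a, vert c} \<noteq> {vert b, vert d}" using l by (auto simp: doubleton_eq_iff)
    ultimately show ?thesis unfolding edges_cross_def by (simp add: segment_convex_hull)
  qed
  with bij show ?thesis by (rule that)
qed

lemma edges_cross_sym: "edges_cross pos e f \<Longrightarrow> edges_cross pos f e"
  unfolding edges_cross_def by blast

lemma rtrancl_image:
  assumes "(x, y) \<in> R\<^sup>*" "\<And>a b. (a, b) \<in> R \<Longrightarrow> (g a, g b) \<in> S"
  shows "(g x, g y) \<in> S\<^sup>*"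
  using assms(1) by induction (auto intro: rtrancl_into_rtrancl assms(2))

theorem theorem10:
  fixes G :: "'a pair_pre_digraph" and pos :: "'a \<Rightarrow> complex" and t :: nat
  assumes "t \<ge> 1"
    and "pair_graph G"
    and "circular_drawing G pos"
    and "\<not> has_topological_complete_minor t (crossing_graph G pos)"
  shows "treewidth G \<le> 6 * t^2 + 6 * t + 1"
proof -
  interpret G: pair_graph G by fact
  let ?V = "pverts G"
  define n where "n = card ?V"
  have finV: "finite ?V" by (rule G.pair_finite_verts)
  show ?thesis
  proof (cases "n \<ge> 2")
    case False
    \<comment> \<open>With fewer than two vertices there is no chord to root a triangulation at; a
      single bag suffices.\<close>
    have "partial_decomposition 1 (\<lambda>_. 0) (\<lambda>_. ?V)" by (simp add: partial_decomposition_def)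
    then show ?thesis
    proof (rule treewidth_le_if_partial_decomposition)
      fix u v assume "(u, v) \<in> parcs G"
      then have "u \<in> ?V" "v \<in> ?V" using G.arc_fst_in_verts G.arc_snd_in_verts by force+
      then show "\<exists>k<1::nat. u \<in> ?V \<and> v \<in> ?V" by auto
    qed (use False in \<open>auto simp: n_def\<close>)
  next
    case n2: True
    obtain vert where bij: "bij_betw vert {..<n} ?V"
      and cross: "\<And>a b c d. a < b \<Longrightarrow> b < c \<Longrightarrow> c < d \<Longrightarrow> d < n \<Longrightarrow> edges_cross pos {vert a, vert c} {vert b, vert d}"
      using circular_drawing_order[OF assms(3) finV] unfolding n_def by blast
    have inj: "inj_on vert {..<n}" using bij by (simp add: bij_betw_def)
    have vertV: "vert i \<in> ?V" if "i < n" for i using bij that by (auto simp: bij_betw_def)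
    define E where "E = {(a, b). a < b \<and> b < n \<and> (vert a, vert b) \<in> parcs G}"
    have E: "\<And>e. e \<in> E \<Longrightarrow> fst e < snd e \<and> snd e < n" by (auto simp: E_def)
    have "E \<subseteq> {..<n} \<times> {..<n}" by (auto simp: E_def)
    then have finE: "finite E" by (rule finite_subset) simp
    define chord where "chord e = {vert (fst e), vert (snd e)}" for e
    have chord_edges: "chord e \<in> edges G" if "e \<in> E" for e
      using that unfolding E_def chord_def edges_def by auto blast
    have chord_inj: "inj_on chord E"
    proof (rule inj_onI)
      fix e f assume e: "e \<in> E" and f: "f \<in> E" and eq: "chord e = chord f"
      have "fst e < n" "snd e < n" "fst f < n" "snd f < n" using E[OF e] E[OF f] by auto
      then have "fst e = fst f \<and> snd e = snd f \<or> fst e = snd f \<and> snd e = fst f"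
        using eq inj unfolding chord_def doubleton_eq_iff inj_on_def by blast
      then show "e = f" using E[OF e] E[OF f] by (auto simp: prod_eq_iff)
    qed
    have chord_cross: "(chord e, chord f) \<in> parcs (crossing_graph G pos)" if "e \<in> E" "f \<in> E" "crosses e f" for e f
    proof -
      have "fst e < fst f \<and> fst f < snd e \<and> snd e < snd f \<or> fst f < fst e \<and> fst e < snd f \<and> snd f < snd e"
        using that(3) E[OF that(1)] E[OF that(2)] unfolding crosses_def separates_def btw_def by auto
      then have "edges_cross pos (chord e) (chord f)"
        using cross[of "fst e" "fst f" "snd e" "snd f"] cross[of "fst f" "fst e" "snd f" "snd e"]
          E[OF that(1)] E[OF that(2)] edges_cross_sym unfolding chord_def by blast
      then show ?thesis using chord_edges that by (simp add: crossing_graph_def)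
    qed
    have shallow: "\<exists>v<n. depth E F v < t ^ 2" if F: "consistent E F" for F
    proof (rule ccontr)
      assume "\<not> (\<exists>v<n. depth E F v < t ^ 2)"
      then have deep: "\<And>v. v < n \<Longrightarrow> depth E F v \<ge> t ^ 2" by force
      obtain B C where BC: "B \<subseteq> E" "card B = t"
        "\<And>i. i < t choose 2 \<Longrightarrow> C i \<subseteq> E - B"
        "\<And>i j. i < t choose 2 \<Longrightarrow> j < t choose 2 \<Longrightarrow> i \<noteq> j \<Longrightarrow> C i \<inter> C j = {}"
        "\<And>i e f. i < t choose 2 \<Longrightarrow> e \<in> C i \<Longrightarrow> f \<in> C i \<Longrightarrow> (e, f) \<in> {(g, h). g \<in> C i \<and> h \<in> C i \<and> crosses g h}\<^sup>*"
        "\<And>i b. i < t choose 2 \<Longrightarrow> b \<in> B \<Longrightarrow> \<exists>f\<in>C i. crosses b f"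
        using deep_imp_linked_covers[OF finE E F _ deep] n2 by auto
      have CE: "C i \<subseteq> E" if "i < t choose 2" for i using BC(3)[OF that] by blast
      have "has_topological_complete_minor t (crossing_graph G pos)"
      proof (rule topological_complete_minorI[of _ "chord ` B" _ "\<lambda>i. chord ` C i"])
        show "pair_wf_digraph (crossing_graph G pos)" by unfold_locales (auto simp: crossing_graph_def)
        show "sym (parcs (crossing_graph G pos))"
          using edges_cross_sym by (auto simp: crossing_graph_def sym_def)
        show "chord ` B \<subseteq> pverts (crossing_graph G pos)" using BC(1) chord_edges by (auto simp: crossing_graph_def)
        show "finite (chord ` B)" using BC(1) finE finite_subset by blast
        show "card (chord ` B) = t" using BC(1,2) chord_inj by (metis card_image inj_on_subset)
      next
        fix i assume i: "i < t choose 2"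
        have "chord ` C i \<inter> chord ` B = {}"
          using BC(1) BC(3)[OF i] inj_on_image_Int[OF chord_inj CE[OF i] BC(1)] by auto
        then show "chord ` C i \<subseteq> pverts (crossing_graph G pos) - chord ` B"
          using CE[OF i] chord_edges by (auto simp: crossing_graph_def)
      next
        fix i j assume "i < t choose 2" "j < t choose 2" "i \<noteq> j"
        then show "chord ` C i \<inter> chord ` C j = {}"
          using inj_on_image_Int[OF chord_inj CE CE, of i j] BC(4)[of i j] by simp
      next
        fix i e f assume i: "i < t choose 2" and "e \<in> chord ` C i" "f \<in> chord ` C i"
        then obtain e' f' where ef: "e = chord e'" "f = chord f'" "e' \<in> C i" "f' \<in> C i" by blast
        show "(e, f) \<in> {(g, h). g \<in> chord ` C i \<and> h \<in> chord ` C i \<and> (g, h) \<in> parcs (crossing_graph G pos)}\<^sup>*"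
          unfolding ef(1,2)
        proof (rule rtrancl_image[OF BC(5)[OF i ef(3,4)]])
          fix g h assume "(g, h) \<in> {(g, h). g \<in> C i \<and> h \<in> C i \<and> crosses g h}"
          then have "g \<in> C i" "h \<in> C i" "(chord g, chord h) \<in> parcs (crossing_graph G pos)"
            using CE[OF i] chord_cross[of g h] by blast+
          then show "(chord g, chord h)
              \<in> {(g, h). g \<in> chord ` C i \<and> h \<in> chord ` C i \<and> (g, h) \<in> parcs (crossing_graph G pos)}"
            by blast
        qed
      next
        fix i b assume i: "i < t choose 2" and "b \<in> chord ` B"
        then obtain b' where b': "b = chord b'" "b' \<in> B" by blast
        obtain f where "f \<in> C i" "crosses b' f" using BC(6)[OF i b'(2)] by blast
        then show "\<exists>f\<in>chord ` C i. (b, f) \<in> parcs (crossing_graph G pos)"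
          using chord_cross[of b' f] b' BC(1) CE[OF i] by blast
      qed
      then show False using assms(4) by blast
    qed
    have "kalmanson.triangulable (crossings E) (2 * t ^ 2) {..<n}"
      using triangulable_if_shallow[OF finE E n2 shallow] .
    moreover have "chords n E" using finE E by unfold_locales force+
    ultimately have "\<exists>N par B. partial_decomposition N par B
      \<and> (\<forall>k<N. B k \<subseteq> {..<n} \<and> card (B k) \<le> 3 + 3 * (2 * t ^ 2))
      \<and> (\<forall>v<n. \<exists>k<N. v \<in> B k) \<and> (\<forall>e\<in>E. \<exists>k<N. fst e \<in> B k \<and> snd e \<in> B k)"
      by (intro chords.triangulable_imp_decomposition)
    then obtain N par B where D: "partial_decomposition N par B"
      "\<forall>k<N. B k \<subseteq> {..<n} \<and> card (B k) \<le> 3 + 3 * (2 * t ^ 2)"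
      "\<forall>v<n. \<exists>k<N. v \<in> B k" "\<forall>e\<in>E. \<exists>k<N. fst e \<in> B k \<and> snd e \<in> B k"
      by (elim exE conjE)
    have Bn: "B k \<subseteq> {..<n}" if "k < N" for k using D(2) that by blast
    have "partial_decomposition N par (\<lambda>k. vert ` B k)"
      unfolding partial_decomposition_def
    proof (intro conjI allI impI)
      show "N \<ge> 1" using D(1) by (simp add: partial_decomposition_def)
      fix k assume k: "0 < k" "k < N"
      show "par k < k" using D(1) k by (simp add: partial_decomposition_def)
      have "(\<Union>j<k. B j) \<subseteq> {..<n}"
      proof (rule UN_least)
        fix j assume "j \<in> {..<k}"
        then show "B j \<subseteq> {..<n}" using Bn[of j] k(2) by simp
      qed
      then have "vert ` B k \<inter> vert ` (\<Union>j<k. B j) = vert ` (B k \<inter> (\<Union>j<k. B j))"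
        using inj_on_image_Int[OF inj Bn[OF k(2)]] by blast
      also have "\<dots> \<subseteq> vert ` B (par k)" using D(1) k by (intro image_mono) (simp add: partial_decomposition_def)
      finally show "vert ` B k \<inter> (\<Union>j<k. vert ` B j) \<subseteq> vert ` B (par k)" by (simp add: image_UN)
    qed
    then show ?thesis
    proof (rule treewidth_le_if_partial_decomposition)
      fix k assume k: "k < N"
      show "vert ` B k \<subseteq> ?V" using Bn[OF k] vertV by auto
      have "finite (B k)" using Bn[OF k] finite_subset by blast
      then have "card (vert ` B k) \<le> card (B k)" by (rule card_image_le)
      also have "\<dots> \<le> 3 + 3 * (2 * t ^ 2)" using D(2) k by blast
      finally show "card (vert ` B k) \<le> 6 * t ^ 2 + 6 * t + 1 + 1" using assms(1) by linarith
    next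
      fix v assume "v \<in> ?V"
      then obtain i where "i < n" "v = vert i" using bij by (auto simp: bij_betw_def)
      then show "\<exists>k<N. v \<in> vert ` B k" using D(3) by blast
    next
      fix u v assume uv: "(u, v) \<in> parcs G"
      then have "u \<in> ?V" "v \<in> ?V" "u \<noteq> v" "(v, u) \<in> parcs G"
        using G.arc_fst_in_verts G.arc_snd_in_verts G.pair_no_loops G.arcs_symmetric by force+
      moreover have "vert ` {..<n} = ?V" using bij by (simp add: bij_betw_def)
      ultimately obtain i j where ij: "i < n" "u = vert i" "j < n" "v = vert j" "i \<noteq> j"
        by (metis imageE lessThan_iff)
      have "(i, j) \<in> E \<or> (j, i) \<in> E" using ij uv \<open>(v, u) \<in> parcs G\<close> by (auto simp: E_def)
      then obtain k where "k < N" "i \<in> B k" "j \<in> B k" using D(4) by force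
      then show "\<exists>k<N. u \<in> vert ` B k \<and> v \<in> vert ` B k" using ij by blast
    qed
  qed
qed



end
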